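(* For any compact regular frame $L$, $L$ is isomorphic to $w\mathsf{O}\mathcal{RO}(\Xi(L))$. Conversely, any $dV$-space $(X,\tau)$ is homeomorphic to $\Xi(w\mathsf{O}\mathcal{RO}(X))$. Moreover, $w\mathsf{O}\mathcal{RO}$ and $\Xi$ extend to contravariant functors establishing a duality (dual equivalence of categories) between the category $\mathbf{KRFrm}$ of compact regular frames and frame morphisms and the category $\mathbf{dVS}$ of $dV$-spaces and $dV$-maps.
   Context: The paper's setting is choice-free: the result is intended without use of the Axiom of Choice or the Boolean Prime Ideal Theorem. Frames. A frame is a complete lattice with $a\wedge\bigvee B=\bigvee\{a\wedge b\mid b\in B\}$; $\neg a$ denotes the pseudo-complement. It is compact if $1_L=\bigvee B$ implies $1_L=\bigvee B'$ for some finite $B'\subseteq B$. In a frame, $a\prec b$ ("$a$ is rather below $b$") iff $b\vee\neg a=1_L$. A compact regular frame is a compact frame $L$ with $a=\bigvee\{b\mid b\prec a\}$ for all $a\in L$. Frame morphisms preserve finite meets and arbitrary joins. The space $\Xi(L)$. For a compact regular frame $L$, $\Xi(L)=(L^-,\delta)$ where $L^-=L\setminus\{1_L\}$ and $\delta$ is the topology generated by the sets $\check a=\{b\in L^-\mid\neg a\prec b\}$, $a\in L$. Topological notation. For a topological space $(X,\tau)$ and $U\subseteq X$: $\overline U$ is the closure, $U^\bot=X\setminus\overline U$, and $\mathsf{RO}(X)$ is the Boolean algebra (ordered by inclusion) of regular open sets, i.e. sets with $U^{\bot\bot}=U$. The specialization preorder is $x\le y$ iff every open set containing $x$ contains $y$.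 Put $\mathord{\downarrow}U=\{x\mid\exists y\in U:x\le y\}$ and $\operatorname{Int}_{\le}U=\{x\mid \forall y\ge x:\ y\in U\}$. $\mathcal{RO}(X)$ is the set of $U\subseteq X$ with $\operatorname{Int}_{\le}(\mathord{\downarrow}U)=U$ (order-regular open sets). For $U,W\subseteq X$, $U\ll W$ iff $\overline U\subseteq\mathord{\downarrow}W$. The frame $w\mathsf{O}\mathcal{RO}(X)$. An open set $U\subseteq X$ is well rounded if for any closed set $C\subseteq\mathord{\downarrow}U$ there are disjoint open sets $W_1,W_2$ with $C\subseteq\mathord{\downarrow}W_1$ and $X\setminus W_2\subseteq\mathord{\downarrow}U$. $w\mathsf{O}\mathcal{RO}(X)$ is the poset, ordered by inclusion, of all subsets of $X$ that are open, order-regular open, and well rounded; for a $dV$-space it is a compact regular frame. $dV$-spaces. Filters are proper. A space $(X,\tau)$ is order-normal if for any closed set $A$ and any regular closed set $B$ with $A\cap\operatorname{Int}_{\le}B=\emptyset$ there are disjoint open sets $U,W$ with $A\subseteq\mathord{\downarrow}U$ and $\operatorname{Int}_{\le}B\subseteq W$. A $dV$-space is a topological space $(X,\tau)$ such that: (i) it is $T_0$, compact and order-normal; (ii) $\mathsf{RO}(X)$ is a basis for $\tau$ and $\mathsf{RO}(X)\subseteq\mathcal{RO}(X)$; (iii) for every $x\in X$, $\mathsf{RO}(x)=\{U\in\mathsf{RO}(X)\mid x\in U\}$ is a concordant filter on $(\mathsf{RO}(X),\ll)$ (a filter $F$ is concordant if every $U\in F$ has some $W\in F$ with $W\ll U$),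 and for every filter $F$ on $\mathsf{RO}(X)$ there is $x\in X$ with $\{U\in F\mid\exists W\in F: W\ll U\}=\mathsf{RO}(x)$. $dV$-maps. A $dV$-map $f:X\to Y$ between $dV$-spaces (with specialization orders $\le_1,\le_2$) is a continuous function that is weakly dense: whenever $f(x)\le_2y$ there is $x'\ge_1x$ with $y\le_2f(x')$. *)

theory Defs
  imports "HOL-Analysis.Abstract_Topological_Spaces" "HOL-Algebra.Complete_Lattice"
begin

section \<open>Compact regular frames\<close>

locale frame = complete_lattice L for L (structure) +
  assumes meet_Sup_distrib:
    "\<lbrakk>a \<in> carrier L; B \<subseteq> carrier L\<rbrakk> \<Longrightarrow> a \<sqinter> \<Squnion>B = \<Squnion>((\<lambda>b. a \<sqinter> b) ` B)"

definition pseudo_complement :: "('a, 'm) gorder_scheme \<Rightarrow> 'a \<Rightarrow> 'a" where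
  "pseudo_complement L a = \<Squnion>\<^bsub>L\<^esub> {x \<in> carrier L. a \<sqinter>\<^bsub>L\<^esub> x = \<bottom>\<^bsub>L\<^esub>}"

definition rather_below :: "('a, 'm) gorder_scheme \<Rightarrow> 'a \<Rightarrow> 'a \<Rightarrow> bool" where
  "rather_below L a b \<longleftrightarrow> b \<squnion>\<^bsub>L\<^esub> pseudo_complement L a = \<top>\<^bsub>L\<^esub>"

locale compact_regular_frame = frame L for L (structure) +
  assumes compact: "\<lbrakk>B \<subseteq> carrier L; \<Squnion>B = \<top>\<rbrakk> \<Longrightarrow> \<exists>B'\<subseteq>B. finite B' \<and> \<Squnion>B' = \<top>"
    and regular: "a \<in> carrier L \<Longrightarrow> a = \<Squnion>{b \<in> carrier L. rather_below L b a}"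

text \<open>Morphisms are extensional functions (equal to \<^const>\<open>undefined\<close> outside the carrier), so that
  equality in HOL is equality of morphisms.\<close>

definition frame_hom :: "'a gorder \<Rightarrow> 'b gorder \<Rightarrow> ('a \<Rightarrow> 'b) set" where
  "frame_hom L M = {f \<in> carrier L \<rightarrow>\<^sub>E carrier M.
     f \<top>\<^bsub>L\<^esub> = \<top>\<^bsub>M\<^esub> \<and>
     (\<forall>a\<in>carrier L. \<forall>b\<in>carrier L. f (a \<sqinter>\<^bsub>L\<^esub> b) = f a \<sqinter>\<^bsub>M\<^esub> f b) \<and>
     (\<forall>B\<subseteq>carrier L. f (\<Squnion>\<^bsub>L\<^esub> B) = \<Squnion>\<^bsub>M\<^esub> (f ` B))}"

definition frame_iso :: "'a gorder \<Rightarrow> 'b gorder \<Rightarrow> ('a \<Rightarrow> 'b) set" where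
  "frame_iso L M = {f \<in> frame_hom L M. \<exists>g \<in> frame_hom M L.
     (\<forall>a\<in>carrier L. g (f a) = a) \<and> (\<forall>b\<in>carrier M. f (g b) = b)}"

section \<open>Regular open and order-regular open sets\<close>

definition perp :: "'a topology \<Rightarrow> 'a set \<Rightarrow> 'a set" where
  "perp X U = topspace X - X closure_of U"

definition RO :: "'a topology \<Rightarrow> 'a set set" where
  "RO X = {U. U \<subseteq> topspace X \<and> perp X (perp X U) = U}"

definition spec_le :: "'a topology \<Rightarrow> 'a \<Rightarrow> 'a \<Rightarrow> bool" where
  "spec_le X x y \<longleftrightarrow> x \<in> topspace X \<and> y \<in> topspace X \<and> (\<forall>U. openin X U \<and> x \<in> U \<longrightarrow> y \<in> U)"

definition down :: "'a topology \<Rightarrow> 'a set \<Rightarrow> 'a set" where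
  "down X U = {x \<in> topspace X. \<exists>y\<in>U. spec_le X x y}"

definition Int_le :: "'a topology \<Rightarrow> 'a set \<Rightarrow> 'a set" where
  "Int_le X U = {x \<in> topspace X. \<forall>y. spec_le X x y \<longrightarrow> y \<in> U}"

definition order_RO :: "'a topology \<Rightarrow> 'a set set" where
  "order_RO X = {U. U \<subseteq> topspace X \<and> Int_le X (down X U) = U}"

definition way_inside :: "'a topology \<Rightarrow> 'a set \<Rightarrow> 'a set \<Rightarrow> bool" where
  "way_inside X U W \<longleftrightarrow> X closure_of U \<subseteq> down X W"

section \<open>The functor $w\mathsf{O}\mathcal{RO}$\<close>

definition well_rounded :: "'a topology \<Rightarrow> 'a set \<Rightarrow> bool" where
  "well_rounded X U \<longleftrightarrow> openin X U \<and>
     (\<forall>C. closedin X C \<and> C \<subseteq> down X U \<longrightarrow>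
       (\<exists>W1 W2. openin X W1 \<and> openin X W2 \<and> W1 \<inter> W2 = {} \<and>
          C \<subseteq> down X W1 \<and> topspace X - W2 \<subseteq> down X U))"

definition wORO :: "'a topology \<Rightarrow> 'a set gorder" where
  "wORO X = \<lparr>carrier = {U. openin X U \<and> U \<in> order_RO X \<and> well_rounded X U},
             eq = (=), le = (\<subseteq>)\<rparr>"

definition wORO_map :: "'a topology \<Rightarrow> 'b topology \<Rightarrow> ('a \<Rightarrow> 'b) \<Rightarrow> 'b set \<Rightarrow> 'a set" where
  "wORO_map X Y f = (\<lambda>U\<in>carrier (wORO Y). {x \<in> topspace X. f x \<in> U})"

section \<open>$dV$-spaces\<close>

definition regular_closedin :: "'a topology \<Rightarrow> 'a set \<Rightarrow> bool" where
  "regular_closedin X B \<longleftrightarrow> B \<subseteq> topspace X \<and> X closure_of (X interior_of B) = B"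

definition order_normal :: "'a topology \<Rightarrow> bool" where
  "order_normal X \<longleftrightarrow>
     (\<forall>A B. closedin X A \<and> regular_closedin X B \<and> A \<inter> Int_le X B = {} \<longrightarrow>
       (\<exists>U W. openin X U \<and> openin X W \<and> U \<inter> W = {} \<and> A \<subseteq> down X U \<and> Int_le X B \<subseteq> W))"

text \<open>Finite meets in the Boolean algebra \<^term>\<open>RO X\<close> are intersections, and its least element is
  the empty set.\<close>

definition RO_filter :: "'a topology \<Rightarrow> 'a set set \<Rightarrow> bool" where
  "RO_filter X F \<longleftrightarrow> F \<subseteq> RO X \<and> F \<noteq> {} \<and> {} \<notin> F \<and>
     (\<forall>U\<in>F. \<forall>W\<in>F. U \<inter> W \<in> F) \<and>
     (\<forall>U\<in>F. \<forall>W\<in>RO X. U \<subseteq> W \<longrightarrow> W \<in> F)"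

definition concordant_filter :: "'a topology \<Rightarrow> 'a set set \<Rightarrow> bool" where
  "concordant_filter X F \<longleftrightarrow> RO_filter X F \<and> (\<forall>U\<in>F. \<exists>W\<in>F. way_inside X W U)"

definition RO_at :: "'a topology \<Rightarrow> 'a \<Rightarrow> 'a set set" where
  "RO_at X x = {U \<in> RO X. x \<in> U}"

definition dV_space :: "'a topology \<Rightarrow> bool" where
  "dV_space X \<longleftrightarrow>
     t0_space X \<and> compact_space X \<and> order_normal X \<and>
     openin X = arbitrary union_of (\<lambda>U. U \<in> RO X) \<and> RO X \<subseteq> order_RO X \<and>
     (\<forall>x\<in>topspace X. concordant_filter X (RO_at X x)) \<and>
     (\<forall>F. RO_filter X F \<longrightarrow>
       (\<exists>x\<in>topspace X. {U \<in> F. \<exists>W\<in>F. way_inside X W U} = RO_at X x))"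

definition weakly_dense :: "'a topology \<Rightarrow> 'b topology \<Rightarrow> ('a \<Rightarrow> 'b) \<Rightarrow> bool" where
  "weakly_dense X Y f \<longleftrightarrow>
     (\<forall>x\<in>topspace X. \<forall>y\<in>topspace Y. spec_le Y (f x) y \<longrightarrow>
       (\<exists>x'\<in>topspace X. spec_le X x x' \<and> spec_le Y y (f x')))"

definition dV_map :: "'a topology \<Rightarrow> 'b topology \<Rightarrow> ('a \<Rightarrow> 'b) set" where
  "dV_map X Y = {f \<in> topspace X \<rightarrow>\<^sub>E topspace Y. continuous_map X Y f \<and> weakly_dense X Y f}"

definition dV_iso :: "'a topology \<Rightarrow> 'b topology \<Rightarrow> ('a \<Rightarrow> 'b) set" where
  "dV_iso X Y = {f \<in> dV_map X Y. \<exists>g \<in> dV_map Y X.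
     (\<forall>x\<in>topspace X. g (f x) = x) \<and> (\<forall>y\<in>topspace Y. f (g y) = y)}"

section \<open>The functor $\Xi$\<close>

definition Xi_points :: "'a gorder \<Rightarrow> 'a set" where
  "Xi_points L = carrier L - {\<top>\<^bsub>L\<^esub>}"

definition Xi_basic :: "'a gorder \<Rightarrow> 'a \<Rightarrow> 'a set" where
  "Xi_basic L a = {b \<in> Xi_points L. rather_below L (pseudo_complement L a) b}"

text \<open>The underlying set of the generated topology is the union of the generators. This is all of
  \<^term>\<open>Xi_points L\<close>, because it is the generator for \<open>a = \<top>\<close>.\<close>

definition Xi :: "'a gorder \<Rightarrow> 'a topology" where
  "Xi L = topology_generated_by (Xi_basic L ` carrier L)"

text \<open>A frame morphism \<open>f : L \<rightarrow> M\<close> preserves joins and so has a right adjoint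
  \<open>b \<mapsto> \<Squnion>{a. f a \<le> b}\<close>; it sends non-top elements of \<open>M\<close> to non-top elements of \<open>L\<close>.\<close>

definition Xi_map :: "'a gorder \<Rightarrow> 'b gorder \<Rightarrow> ('a \<Rightarrow> 'b) \<Rightarrow> 'b \<Rightarrow> 'a" where
  "Xi_map L M f = (\<lambda>b\<in>Xi_points M. \<Squnion>\<^bsub>L\<^esub> {a \<in> carrier L. f a \<sqsubseteq>\<^bsub>M\<^esub> b})"

section \<open>Categories and contravariant functors\<close>

text \<open>Hom-sets need not be disjoint; hence composition and the arrow part of a functor also take the
  objects involved. \<open>Comp C A B D g f\<close> is \<open>g\<close> after \<open>f\<close>, for \<open>f : A \<rightarrow> B\<close> and \<open>g : B \<rightarrow> D\<close>.\<close>

record ('o, 'h) cat =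
  Obj :: "'o set"
  Hom :: "'o \<Rightarrow> 'o \<Rightarrow> 'h set"
  Ident :: "'o \<Rightarrow> 'h"
  Comp :: "'o \<Rightarrow> 'o \<Rightarrow> 'o \<Rightarrow> 'h \<Rightarrow> 'h \<Rightarrow> 'h"

definition category :: "('o, 'h) cat \<Rightarrow> bool" where
  "category C \<longleftrightarrow>
     (\<forall>A\<in>Obj C. Ident C A \<in> Hom C A A) \<and>
     (\<forall>A\<in>Obj C. \<forall>B\<in>Obj C. \<forall>D\<in>Obj C. \<forall>f\<in>Hom C A B. \<forall>g\<in>Hom C B D.
        Comp C A B D g f \<in> Hom C A D) \<and>
     (\<forall>A\<in>Obj C. \<forall>B\<in>Obj C. \<forall>f\<in>Hom C A B.
        Comp C A A B f (Ident C A) = f \<and> Comp C A B B (Ident C B) f = f) \<and>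
     (\<forall>A\<in>Obj C. \<forall>B\<in>Obj C. \<forall>D\<in>Obj C. \<forall>E\<in>Obj C.
        \<forall>f\<in>Hom C A B. \<forall>g\<in>Hom C B D. \<forall>h\<in>Hom C D E.
        Comp C A D E h (Comp C A B D g f) = Comp C A B E (Comp C B D E h g) f)"

definition contravariant_functor ::
  "('o, 'h) cat \<Rightarrow> ('p, 'k) cat \<Rightarrow> ('o \<Rightarrow> 'p) \<Rightarrow> ('o \<Rightarrow> 'o \<Rightarrow> 'h \<Rightarrow> 'k) \<Rightarrow> bool" where
  "contravariant_functor C D Fo Fm \<longleftrightarrow>
     category C \<and> category D \<and>
     (\<forall>A\<in>Obj C. Fo A \<in> Obj D) \<and>
     (\<forall>A\<in>Obj C. \<forall>B\<in>Obj C. \<forall>f\<in>Hom C A B. Fm A B f \<in> Hom D (Fo B) (Fo A)) \<and>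
     (\<forall>A\<in>Obj C. Fm A A (Ident C A) = Ident D (Fo A)) \<and>
     (\<forall>A\<in>Obj C. \<forall>B\<in>Obj C. \<forall>E\<in>Obj C. \<forall>f\<in>Hom C A B. \<forall>g\<in>Hom C B E.
        Fm A E (Comp C A B E g f) = Comp D (Fo E) (Fo B) (Fo A) (Fm A B f) (Fm B E g))"

text \<open>The categories of compact regular frames and of \<open>dV\<close>-spaces whose elements are drawn from an
  arbitrary type \<open>'a\<close>, which plays the role of a universe.\<close>

definition KRFrm :: "('a gorder, 'a \<Rightarrow> 'a) cat" where
  "KRFrm = \<lparr>Obj = {L. compact_regular_frame L}, Hom = frame_hom,
            Ident = (\<lambda>L. \<lambda>a\<in>carrier L. a),
            Comp = (\<lambda>L M N g f. compose (carrier L) g f)\<rparr>"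

definition dVS :: "('a topology, 'a \<Rightarrow> 'a) cat" where
  "dVS = \<lparr>Obj = {X. dV_space X}, Hom = dV_map,
          Ident = (\<lambda>X. \<lambda>x\<in>topspace X. x),
          Comp = (\<lambda>X Y Z g f. compose (topspace X) g f)\<rparr>"

text \<open>Elements of \<open>wORO X\<close> are subsets of \<open>X\<close>, so the composites \<open>wORO \<circ> Xi\<close> and \<open>Xi \<circ> wORO\<close> lead from
  objects over \<open>'a\<close> to objects over \<open>'a set\<close>. The predicates below say that \<open>\<eta>\<close> (resp. \<open>\<epsilon>\<close>) is a
  natural isomorphism from the identity to the composite: its components are isomorphisms between
  objects over the two types, and all naturality squares commute.\<close>

definition natural_iso_wORO_Xi :: "('a gorder \<Rightarrow> 'a \<Rightarrow> 'a set) \<Rightarrow> bool" where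
  "natural_iso_wORO_Xi \<eta> \<longleftrightarrow>
     (\<forall>L\<in>Obj KRFrm. \<eta> L \<in> frame_iso L (wORO (Xi L))) \<and>
     (\<forall>L\<in>Obj KRFrm. \<forall>M\<in>Obj KRFrm. \<forall>f\<in>Hom KRFrm L M.
        compose (carrier L) (wORO_map (Xi M) (Xi L) (Xi_map L M f)) (\<eta> L)
          = compose (carrier L) (\<eta> M) f)"

definition natural_iso_Xi_wORO :: "('a topology \<Rightarrow> 'a \<Rightarrow> 'a set) \<Rightarrow> bool" where
  "natural_iso_Xi_wORO \<epsilon> \<longleftrightarrow>
     (\<forall>X\<in>Obj dVS. \<epsilon> X \<in> dV_iso X (Xi (wORO X))) \<and>
     (\<forall>X\<in>Obj dVS. \<forall>Y\<in>Obj dVS. \<forall>f\<in>Hom dVS X Y.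
        compose (topspace X) (Xi_map (wORO Y) (wORO X) (wORO_map X Y f)) (\<epsilon> X)
          = compose (topspace X) (\<epsilon> Y) f)"

end

theory Submission
  imports Defs
begin

text \<open>Classically, if \<open>L\<close> is the topology of a compact Hausdorff space \<open>K\<close>, then \<open>Xi L\<close> is the
  upper Vietoris space of nonempty closed subsets of \<open>K\<close>, an element \<open>b \<noteq> \<top>\<close> standing for the
  complement of the open set \<open>b\<close>. Its specialization order is the order of \<open>L\<close>. An open set \<open>U\<close>
  is determined up to order-regularization by the join \<open>a\<close> of the elements whose box
  \<open>{b. b \<squnion> a = \<top>}\<close> lies in \<open>U\<close>, and so the boxes are exactly the order-regular open sets; the boxes
  of regular elements \<open>a = \<not>\<not>a\<close> are the regular open sets.

  Conversely, in a \<open>dV\<close>-space the complement of \<open>down X V\<close>, for \<open>V\<close> open, is empty or a principal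
  up-set. More generally, for a directed family of such \<open>V\<close> these complements are either eventually
  empty or intersect in a principal up-set, and the latter gives both the compactness of \<open>wORO X\<close> and
  the openness of order-regularizations of open sets. It follows that the elements of \<open>wORO X\<close> other
  than the top are the sets \<open>eps X x\<close> of those points that have no common upper bound with \<open>x\<close>, and
  \<open>eps X\<close> is the homeomorphism onto \<open>Xi (wORO X)\<close>.\<close>

section \<open>Regular open sets and the specialization order\<close>

text \<open>No point is obtained from a maximal or prime filter. \<open>Xi L\<close> takes every
  element but \<open>\<top>\<close> as a point, and in a dV-space points come from the filter
  condition, which \<open>directed_point\<close> applies to an explicitly described filter.
  Compactness arguments on the side of spaces run through this lemma in the form: if a nonempty
  directed family of open sets has no member whose \<open>down\<close> is everything, then some
  point avoids all these down-sets. The two sides are matched by covers. On the frame side the basic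
  datum is \<open>b \<squnion> a = \<top>\<close>; in \<open>wORO X\<close> a join is the top iff
  the down-sets of its members cover the space. \<open>join_eq_top_shrink\<close> and
  \<open>RO_shrink\<close> are the corresponding shrinking principles. The obstacle is that
  \<open>\<lless>\<close>, order-normality and well-roundedness speak of closed sets, while a point
  is known only through its regular neighbourhoods. \<open>way_inside_perp\<close> bridges this:
  passing to exteriors reverses \<open>way_inside\<close>, and the closure of an exterior is the
  complement of the original regular set. For morphisms, weak density makes inverse images commute
  with order-regularization, hence with joins.\<close>

lemma perp_eq_interior: "perp X U = X interior_of (topspace X - U)"
  by (simp add: perp_def interior_of_closure_of Diff_Diff_Int flip: closure_of_restrict)

lemma openin_perp [simp]: "openin X (perp X U)"
  by (simp add: perp_eq_interior)

lemma perp_antimono: "U \<subseteq> V \<Longrightarrow> perp X V \<subseteq> perp X U"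
  by (simp add: perp_def Diff_mono closure_of_mono)

lemma perp_subset: "perp X U \<subseteq> topspace X"
  by (auto simp: perp_def)

lemma perp_disjoint: "openin X U \<Longrightarrow> U \<inter> perp X U = {}"
  using closure_of_subset [of U X] openin_subset [of X U] by (auto simp: perp_def)

lemma subset_perp_iff: "\<lbrakk>openin X U; openin X V\<rbrakk> \<Longrightarrow> V \<subseteq> perp X U \<longleftrightarrow> V \<inter> U = {}"
  using openin_subset [of X V] by (auto simp: perp_eq_interior interior_of_maximal_eq)

lemma subset_perp_perp: "openin X U \<Longrightarrow> U \<subseteq> perp X (perp X U)"
  using perp_disjoint [of X U] by (simp add: subset_perp_iff)

lemma perp_perp_perp: "openin X U \<Longrightarrow> perp X (perp X (perp X U)) = perp X U"
  by (simp add: perp_antimono subset_antisym subset_perp_perp)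

lemma RO_openin: "U \<in> RO X \<Longrightarrow> openin X U"
  by (metis (mono_tags, lifting) RO_def mem_Collect_eq openin_perp)

lemma RO_subset: "U \<in> RO X \<Longrightarrow> U \<subseteq> topspace X"
  by (simp add: RO_def)

lemma RO_perp_perp: "U \<in> RO X \<Longrightarrow> perp X (perp X U) = U"
  by (simp add: RO_def)

lemma perp_in_RO: "openin X U \<Longrightarrow> perp X U \<in> RO X"
  by (simp add: RO_def perp_subset perp_perp_perp)

lemma RO_Int:
  assumes "U \<in> RO X" "V \<in> RO X" shows "U \<inter> V \<in> RO X"
proof -
  have "openin X (U \<inter> V)" using assms by (simp add: RO_openin openin_Int)
  moreover have "perp X (perp X (U \<inter> V)) \<subseteq> U \<inter> V"
    using assms RO_perp_perp perp_antimono by (metis Int_lower1 Int_lower2 le_inf_iff)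
  ultimately have "perp X (perp X (U \<inter> V)) = U \<inter> V"
    by (simp add: subset_antisym subset_perp_perp)
  then show ?thesis using assms RO_subset by (auto simp: RO_def)
qed

lemma topspace_in_RO: "topspace X \<in> RO X"
  by (simp add: RO_def perp_def)

lemma closure_of_perp: "U \<in> RO X \<Longrightarrow> X closure_of (perp X U) = topspace X - U"
  using RO_perp_perp [of U X] closure_of_subset_topspace [of X "perp X U"]
  by (auto simp: perp_def [of X "perp X U"])

section \<open>The specialization order\<close>

lemma spec_le_refl: "x \<in> topspace X \<Longrightarrow> spec_le X x x"
  by (simp add: spec_le_def)

lemma spec_le_trans: "\<lbrakk>spec_le X x y; spec_le X y z\<rbrakk> \<Longrightarrow> spec_le X x z"
  by (auto simp: spec_le_def)

lemma spec_le_openin: "\<lbrakk>spec_le X x y; openin X U; x \<in> U\<rbrakk> \<Longrightarrow> y \<in> U"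
  by (auto simp: spec_le_def)

lemma spec_leD: "spec_le X x y \<Longrightarrow> x \<in> topspace X \<and> y \<in> topspace X"
  by (auto simp: spec_le_def)

lemma mem_down: "x \<in> down X U \<longleftrightarrow> (\<exists>y\<in>U. spec_le X x y)"
  by (auto simp: down_def spec_le_def)

lemma mem_Int_le: "x \<in> Int_le X U \<longleftrightarrow> x \<in> topspace X \<and> (\<forall>y. spec_le X x y \<longrightarrow> y \<in> U)"
  by (auto simp: Int_le_def)

lemma down_subset: "down X U \<subseteq> topspace X"
  by (auto simp: down_def)

lemma subset_down: "U \<subseteq> topspace X \<Longrightarrow> U \<subseteq> down X U"
  using spec_le_refl unfolding down_def by fast

lemma down_mono: "U \<subseteq> V \<Longrightarrow> down X U \<subseteq> down X V"
  unfolding down_def by fast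

lemma down_down: "down X (down X U) = down X U"
proof
  show "down X (down X U) \<subseteq> down X U"
    unfolding down_def using spec_le_trans by fast
qed (simp add: down_subset subset_down)

lemma down_Union: "down X (\<Union>K) = (\<Union>U\<in>K. down X U)"
  unfolding down_def by blast

lemma Int_le_mono: "U \<subseteq> V \<Longrightarrow> Int_le X U \<subseteq> Int_le X V"
  unfolding Int_le_def by fast

lemma Int_le_subset: "Int_le X U \<subseteq> U"
  unfolding Int_le_def using spec_le_refl by fast

lemma Int_le_diff: "Int_le X (topspace X - U) = topspace X - down X U"
  by (auto simp: mem_Int_le mem_down dest: spec_leD)

lemma openin_subset_Int_le_down: "openin X U \<Longrightarrow> U \<subseteq> Int_le X (down X U)"
  using openin_subset [of X U] spec_le_openin spec_le_refl spec_leD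
  unfolding Int_le_def down_def by fast

text \<open>Sandwich \<open>U \<subseteq> Int_le X (down X U) \<subseteq> down X U\<close> and apply
  the idempotent operator \<open>down\<close>. This is what makes \<open>ohull\<close> idempotent on
  open sets.\<close>

lemma down_Int_le_down: "openin X U \<Longrightarrow> down X (Int_le X (down X U)) = down X U"
  by (metis Int_le_subset down_down down_mono openin_subset_Int_le_down subset_antisym)

lemma down_Un: "down X (U \<union> V) = down X U \<union> down X V"
  by (auto simp: mem_down)

text \<open>In the Alexandrov topology of up-sets, \<open>down\<close> is closure and
  \<open>Int_le\<close> is interior. So this is regularization in that topology, and
  \<open>order_RO X\<close> consists of its fixed points.\<close>

definition ohull :: "'a topology \<Rightarrow> 'a set \<Rightarrow> 'a set" where
  "ohull X V = Int_le X (down X V)"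

lemma ohull_mono: "U \<subseteq> V \<Longrightarrow> ohull X U \<subseteq> ohull X V"
  by (simp add: ohull_def Int_le_mono down_mono)

lemma subset_ohull: "openin X V \<Longrightarrow> V \<subseteq> ohull X V"
  by (simp add: ohull_def openin_subset_Int_le_down)

lemma down_ohull: "openin X V \<Longrightarrow> down X (ohull X V) = down X V"
  by (simp add: ohull_def down_Int_le_down)

lemma ohull_ohull: "openin X V \<Longrightarrow> ohull X (ohull X V) = ohull X V"
  by (simp add: ohull_def down_Int_le_down)

lemma mem_ohull: "x \<in> ohull X V \<longleftrightarrow> x \<in> topspace X \<and> (\<forall>y. spec_le X x y \<longrightarrow> y \<in> down X V)"
  by (simp add: ohull_def mem_Int_le)

lemma mem_down_below: "\<lbrakk>y \<in> down X V; spec_le X x y\<rbrakk> \<Longrightarrow> x \<in> down X V"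
  unfolding mem_down by (meson spec_le_trans)

lemma order_RO_iff_ohull: "U \<in> order_RO X \<longleftrightarrow> U \<subseteq> topspace X \<and> ohull X U = U"
  by (simp add: order_RO_def ohull_def)

text \<open>Turns equations with the top into covering statements: \<open>down\<close> commutes with
  unions, so a join equal to the top can be analysed member by member.\<close>

lemma ohull_eq_topspace: "ohull X V = topspace X \<longleftrightarrow> down X V = topspace X"
proof
  assume "ohull X V = topspace X"
  then show "down X V = topspace X"
    using Int_le_subset [of X "down X V"] down_subset [of X V] by (simp add: ohull_def)
next
  assume "down X V = topspace X"
  then show "ohull X V = topspace X"
    using spec_leD [of X] unfolding ohull_def Int_le_def by fastforce
qed

text \<open>Open sets are up-sets, so a point of \<open>V\<close> reached by going up from a point
  of \<open>U\<close> still lies in \<open>U\<close>. Closure of \<open>wORO X\<close> under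
  intersection and the frame law both come from here.\<close>

lemma Int_ohull:
  assumes "openin X U" "ohull X U = U" "openin X V"
  shows "U \<inter> ohull X V = ohull X (U \<inter> V)"
proof
  show "ohull X (U \<inter> V) \<subseteq> U \<inter> ohull X V"
    using ohull_mono [of "U \<inter> V" U X] ohull_mono [of "U \<inter> V" V X] assms by auto
  show "U \<inter> ohull X V \<subseteq> ohull X (U \<inter> V)"
  proof
    fix y assume y: "y \<in> U \<inter> ohull X V"
    have "z \<in> down X (U \<inter> V)" if z: "spec_le X y z" for z
    proof -
      have "z \<in> down X V" using y z by (simp add: mem_ohull)
      then obtain w where "w \<in> V" "spec_le X z w" by (auto simp: mem_down)
      then show ?thesis
        using y z assms(1) unfolding mem_down by (meson IntD1 IntI spec_le_openin)
    qed
    then show "y \<in> ohull X (U \<inter> V)" using y by (auto simp: mem_ohull)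
  qed
qed

text \<open>The union of the exteriors of the regular neighbourhoods of \<open>x\<close>. This form
  makes the set visibly open, so that its hull is an element of \<open>wORO X\<close>; the
  description by common upper bounds is derived in \<open>mem_eps\<close>.\<close>

definition away :: "'a topology \<Rightarrow> 'a \<Rightarrow> 'a set" where
  "away X x = \<Union>(perp X ` RO_at X x)"

definition eps :: "'a topology \<Rightarrow> 'a \<Rightarrow> 'a set" where
  "eps X x = ohull X (away X x)"

lemma openin_away: "openin X (away X x)"
  unfolding away_def by (rule openin_Union) auto

section \<open>Compact regular frames\<close>

context frame
begin

lemma join_iff:
  "\<lbrakk>a \<in> carrier L; b \<in> carrier L; c \<in> carrier L\<rbrakk> \<Longrightarrow> a \<squnion> b \<sqsubseteq> c \<longleftrightarrow> a \<sqsubseteq> c \<and> b \<sqsubseteq> c"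
  by (meson join_closed join_le join_left join_right le_trans)

lemma meet_iff:
  "\<lbrakk>a \<in> carrier L; b \<in> carrier L; c \<in> carrier L\<rbrakk> \<Longrightarrow> c \<sqsubseteq> a \<sqinter> b \<longleftrightarrow> c \<sqsubseteq> a \<and> c \<sqsubseteq> b"
  by (meson meet_closed meet_le meet_left meet_right le_trans)

lemma Sup_iff:
  "\<lbrakk>A \<subseteq> carrier L; c \<in> carrier L\<rbrakk> \<Longrightarrow> \<Squnion>A \<sqsubseteq> c \<longleftrightarrow> (\<forall>a\<in>A. a \<sqsubseteq> c)"
  by (meson le_trans subsetD sup_closed sup_least sup_upper)

lemma top_le_iff [simp]: "a \<in> carrier L \<Longrightarrow> \<top> \<sqsubseteq> a \<longleftrightarrow> a = \<top>"
  by (metis le_antisym top_closed top_higher)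

lemma le_bot_iff [simp]: "a \<in> carrier L \<Longrightarrow> a \<sqsubseteq> \<bottom> \<longleftrightarrow> a = \<bottom>"
  by (metis le_antisym bottom_closed bottom_lower)

lemma meet_top [simp]: "a \<in> carrier L \<Longrightarrow> a \<sqinter> \<top> = a"
  using le_iff_join [of a \<top>] by simp

lemma join_top [simp]: "a \<in> carrier L \<Longrightarrow> \<top> \<squnion> a = \<top>"
  using join_left [of \<top> a] by simp

lemma meet_bot [simp]: "a \<in> carrier L \<Longrightarrow> a \<sqinter> \<bottom> = \<bottom>"
  using meet_right [of a \<bottom>] by simp

lemma le_joinI1: "\<lbrakk>x \<sqsubseteq> a; x \<in> carrier L; a \<in> carrier L; b \<in> carrier L\<rbrakk> \<Longrightarrow> x \<sqsubseteq> a \<squnion> b"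
  by (rule le_trans [OF _ join_left]) auto

lemma le_joinI2: "\<lbrakk>x \<sqsubseteq> b; x \<in> carrier L; a \<in> carrier L; b \<in> carrier L\<rbrakk> \<Longrightarrow> x \<sqsubseteq> a \<squnion> b"
  by (rule le_trans [OF _ join_right]) auto

lemma meet_leI1: "\<lbrakk>a \<sqsubseteq> x; x \<in> carrier L; a \<in> carrier L; b \<in> carrier L\<rbrakk> \<Longrightarrow> a \<sqinter> b \<sqsubseteq> x"
  by (rule le_trans [OF meet_left]) auto

lemma meet_leI2: "\<lbrakk>b \<sqsubseteq> x; x \<in> carrier L; a \<in> carrier L; b \<in> carrier L\<rbrakk> \<Longrightarrow> a \<sqinter> b \<sqsubseteq> x"
  by (rule le_trans [OF meet_right]) auto

lemma join_mono:
  "\<lbrakk>a \<sqsubseteq> a'; b \<sqsubseteq> b'; a \<in> carrier L; b \<in> carrier L; a' \<in> carrier L; b' \<in> carrier L\<rbrakk>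
    \<Longrightarrow> a \<squnion> b \<sqsubseteq> a' \<squnion> b'"
  by (simp add: join_iff le_joinI1 le_joinI2)

lemma meet_mono:
  "\<lbrakk>a \<sqsubseteq> a'; b \<sqsubseteq> b'; a \<in> carrier L; b \<in> carrier L; a' \<in> carrier L; b' \<in> carrier L\<rbrakk>
    \<Longrightarrow> a \<sqinter> b \<sqsubseteq> a' \<sqinter> b'"
  by (simp add: meet_iff meet_leI1 meet_leI2)

lemma meet_join_distrib:
  assumes "a \<in> carrier L" "b \<in> carrier L" "c \<in> carrier L"
  shows "a \<sqinter> (b \<squnion> c) = (a \<sqinter> b) \<squnion> (a \<sqinter> c)"
  using meet_Sup_distrib [of a "{b, c}"] assms by (simp add: join_def)

text \<open>The point-free form of: what is disjoint from \<open>a\<close> lies in \<open>b\<close>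
  when \<open>a\<close> and \<open>b\<close> cover everything. Distribute \<open>x\<close> over the
  cover.\<close>

lemma le_of_join_eq_top:
  assumes "x \<in> carrier L" "a \<in> carrier L" "b \<in> carrier L" "b \<squnion> a = \<top>" "x \<sqinter> a = \<bottom>"
  shows "x \<sqsubseteq> b"
proof -
  have "x = x \<sqinter> (b \<squnion> a)"
    using assms by simp
  also have "\<dots> = (x \<sqinter> b) \<squnion> (x \<sqinter> a)"
    using assms by (intro meet_join_distrib)
  also have "\<dots> \<sqsubseteq> b"
    using assms by (simp add: join_iff meet_leI2)
  finally show ?thesis .
qed

lemma join_eq_top_mono:
  assumes "a \<in> carrier L" "b \<in> carrier L" "a' \<in> carrier L" "b' \<in> carrier L"
    and "b \<squnion> a = \<top>" "b \<sqsubseteq> b'" "a \<sqsubseteq> a'"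
  shows "b' \<squnion> a' = \<top>"
proof -
  have "b \<squnion> a \<sqsubseteq> b' \<squnion> a'"
    using assms by (intro join_mono)
  then show ?thesis using assms by simp
qed

lemma join_eq_top_mono_right:
  "\<lbrakk>b \<squnion> a = \<top>; a \<sqsubseteq> a'; a \<in> carrier L; b \<in> carrier L; a' \<in> carrier L\<rbrakk> \<Longrightarrow> b \<squnion> a' = \<top>"
  by (rule join_eq_top_mono [of a b]) auto

text \<open>The dual distributive law for covers, obtained from the frame law by distributing
  \<open>a\<close> over \<open>b \<squnion> c = \<top>\<close>.\<close>

lemma join_meet_eq_top:
  assumes "a \<in> carrier L" "b \<in> carrier L" "c \<in> carrier L" "b \<squnion> a = \<top>" "b \<squnion> c = \<top>"
  shows "b \<squnion> (a \<sqinter> c) = \<top>"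
proof -
  have "a = a \<sqinter> (b \<squnion> c)"
    using assms by simp
  also have "\<dots> = (a \<sqinter> b) \<squnion> (a \<sqinter> c)"
    using assms by (intro meet_join_distrib)
  also have "\<dots> \<sqsubseteq> b \<squnion> (a \<sqinter> c)"
    using assms by (intro join_iff [THEN iffD2] conjI) (simp_all add: le_joinI1 le_joinI2 meet_leI2)
  finally have "b \<squnion> a \<sqsubseteq> b \<squnion> (a \<sqinter> c)"
    using assms by (intro join_iff [THEN iffD2] conjI join_left) auto
  then have "\<top> \<sqsubseteq> b \<squnion> (a \<sqinter> c)" by (simp only: assms)
  then show ?thesis using assms by simp
qed

section \<open>Pseudo-complements and the rather-below relation\<close>

abbreviation neg :: "'a \<Rightarrow> 'a" where "neg \<equiv> pseudo_complement L"
abbreviation rb :: "'a \<Rightarrow> 'a \<Rightarrow> bool" (infix \<open>\<lless>\<close> 50) where "a \<lless> b \<equiv> rather_below L a b"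

lemma neg_closed [simp]: "neg a \<in> carrier L"
  unfolding pseudo_complement_def by (rule sup_closed) auto

lemma meet_neg: assumes "a \<in> carrier L" shows "a \<sqinter> neg a = \<bottom>"
proof -
  let ?B = "{x \<in> carrier L. a \<sqinter> x = \<bottom>}"
  have "a \<sqinter> neg a = \<Squnion>((\<lambda>b. a \<sqinter> b) ` ?B)"
    unfolding pseudo_complement_def using assms by (intro meet_Sup_distrib) auto
  also have "\<dots> \<sqsubseteq> \<bottom>"
    using assms by (subst Sup_iff) auto
  finally show ?thesis using assms by simp
qed

lemma le_neg_iff:
  assumes "a \<in> carrier L" "x \<in> carrier L" shows "x \<sqsubseteq> neg a \<longleftrightarrow> a \<sqinter> x = \<bottom>"
proof
  assume "x \<sqsubseteq> neg a"
  then have "a \<sqinter> x \<sqsubseteq> a \<sqinter> neg a"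
    using assms by (intro meet_mono) auto
  then show "a \<sqinter> x = \<bottom>"
    using assms by (simp add: meet_neg)
next
  assume "a \<sqinter> x = \<bottom>"
  then show "x \<sqsubseteq> neg a"
    unfolding pseudo_complement_def using assms by (intro sup_upper) auto
qed

lemma neg_antimono:
  assumes "a \<in> carrier L" "b \<in> carrier L" "a \<sqsubseteq> b" shows "neg b \<sqsubseteq> neg a"
proof -
  have "a \<sqinter> neg b \<sqsubseteq> b \<sqinter> neg b"
    using assms by (intro meet_mono) auto
  then show ?thesis using assms by (simp add: le_neg_iff meet_neg)
qed

lemma le_neg_neg: "a \<in> carrier L \<Longrightarrow> a \<sqsubseteq> neg (neg a)"
  by (metis le_neg_iff meet_comm meet_neg neg_closed)

lemma neg_neg_neg: "a \<in> carrier L \<Longrightarrow> neg (neg (neg a)) = neg a"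
  by (rule le_antisym) (simp_all add: le_neg_neg neg_antimono)

lemma rather_below_iff: "a \<lless> b \<longleftrightarrow> b \<squnion> neg a = \<top>"
  by (simp add: rather_below_def)

lemma rather_below_le:
  assumes "a \<in> carrier L" "b \<in> carrier L" "a \<lless> b" shows "a \<sqsubseteq> b"
  using assms by (auto simp: rather_below_iff meet_neg intro: le_of_join_eq_top [of a "neg a" b])

text \<open>Lets a regular element be interpolated between \<open>a\<close> and \<open>b\<close>;
  this is how boxes of regular elements come to form a base of \<open>Xi L\<close>.\<close>

lemma neg_neg_le_if_rather_below:
  assumes "a \<in> carrier L" "b \<in> carrier L" "a \<lless> b" shows "neg (neg a) \<sqsubseteq> b"
  using assms
  by (auto simp: rather_below_iff meet_neg meet_comm [of L "neg (neg a)" "neg a"] intro: le_of_join_eq_top [of _ "neg a" b])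

lemma rather_below_join:
  assumes "a \<in> carrier L" "b \<in> carrier L" "c \<in> carrier L" "a \<lless> c" "b \<lless> c"
  shows "a \<squnion> b \<lless> c"
proof -
  have "c \<squnion> (neg a \<sqinter> neg b) = \<top>"
    using assms by (simp add: rather_below_iff join_meet_eq_top)
  \<comment> \<open>Half of De Morgan's law. Disjointness is symmetric, so
    \<open>n \<sqsubseteq> neg c\<close> and \<open>c \<sqsubseteq> neg n\<close> are equivalent,
    and the second can be checked on \<open>a\<close> and \<open>b\<close> separately.\<close>
  moreover have "neg a \<sqinter> neg b \<sqsubseteq> neg (a \<squnion> b)"
  proof -
    let ?n = "neg a \<sqinter> neg b"
    have "neg (neg a) \<sqsubseteq> neg ?n" "neg (neg b) \<sqsubseteq> neg ?n"
      by (auto intro!: neg_antimono meet_left meet_right)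
    then have "a \<sqsubseteq> neg ?n" "b \<sqsubseteq> neg ?n"
      using assms by (auto intro: le_trans [OF le_neg_neg])
    then have "a \<squnion> b \<sqsubseteq> neg ?n" using assms by (simp add: join_iff)
    then show ?thesis
      using assms by (metis join_closed le_neg_iff meet_closed meet_comm neg_closed)
  qed
  ultimately show ?thesis
    using assms join_eq_top_mono [of "neg a \<sqinter> neg b" c "neg (a \<squnion> b)" c]
    by (simp add: rather_below_iff)
qed

lemma bot_rather_below: assumes "a \<in> carrier L" shows "\<bottom> \<lless> a"
proof -
  have "neg \<bottom> = \<top>"
    by (simp add: le_neg_iff meet_comm flip: top_le_iff)
  then show ?thesis
    using assms by (simp add: rather_below_iff join_comm [of L a \<top>])
qed

end

section \<open>Compactness and regularity combined\<close>

context compact_regular_frame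
begin

text \<open>Compactness relative to \<open>b\<close>: a finite part of \<open>insert b D\<close>
  already has join \<open>\<top>\<close>, and directedness absorbs this part into \<open>b\<close>
  and a single member of \<open>D\<close>.\<close>

lemma compact_directed:
  assumes "b \<in> carrier L" and D: "D \<subseteq> carrier L" "D \<noteq> {}"
    and dir: "\<And>x y. \<lbrakk>x \<in> D; y \<in> D\<rbrakk> \<Longrightarrow> \<exists>z\<in>D. x \<sqsubseteq> z \<and> y \<sqsubseteq> z"
    and top: "b \<squnion> \<Squnion>D = \<top>"
  shows "\<exists>d\<in>D. b \<squnion> d = \<top>"
proof -
  have "insert b D \<subseteq> carrier L" using assms by auto
  then have "b \<squnion> \<Squnion>D \<sqsubseteq> \<Squnion>(insert b D)"
    using assms by (intro join_iff [THEN iffD2] conjI Sup_iff [THEN iffD2] ballI sup_upper) auto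
  then have "\<Squnion>(insert b D) = \<top>"
    using assms \<open>insert b D \<subseteq> carrier L\<close> by simp
  then obtain B where B: "B \<subseteq> insert b D" "finite B" "\<Squnion>B = \<top>"
    using compact \<open>insert b D \<subseteq> carrier L\<close> by metis
  \<comment> \<open>The bound is \<open>b \<squnion> d\<close> rather than \<open>d\<close>, so that
    the element \<open>b\<close> of the finite cover needs no separate case in the conclusion.
    Nonemptiness of \<open>D\<close> starts the induction.\<close>
  from B(2,1) have "\<exists>d\<in>D. \<forall>x\<in>B. x \<sqsubseteq> b \<squnion> d"
  proof induction
    case empty
    then show ?case using D by auto
  next
    case (insert x F)
    then obtain d where d: "d \<in> D" "\<forall>x\<in>F. x \<sqsubseteq> b \<squnion> d" by auto
    obtain e where e: "e \<in> D" "d \<sqsubseteq> e" "x \<sqsubseteq> b \<squnion> e"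
    proof (cases "x \<in> D")
      case True
      then obtain e where "e \<in> D" "d \<sqsubseteq> e" "x \<sqsubseteq> e" using dir d by blast
      moreover have "e \<sqsubseteq> b \<squnion> e" using \<open>e \<in> D\<close> assms by (intro join_right) auto
      ultimately show ?thesis
        using that True assms by (meson join_closed le_trans subsetD)
    next
      case False
      then have "x = b" using insert by auto
      moreover have "d \<in> carrier L" using d assms by auto
      ultimately show ?thesis using that [of d] d assms by (simp add: join_left)
    qed
    have "b \<squnion> d \<sqsubseteq> b \<squnion> e"
      using d e assms by (intro join_mono) auto
    moreover have "F \<subseteq> carrier L" using insert.prems assms by auto
    ultimately have "\<forall>y\<in>F. y \<sqsubseteq> b \<squnion> e"
      using d e(1) assms by (meson join_closed le_trans subsetD)
    then show ?case using e by auto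
  qed
  then obtain d where "d \<in> D" "\<forall>x\<in>B. x \<sqsubseteq> b \<squnion> d" by blast
  moreover have "B \<subseteq> carrier L" "d \<in> carrier L" using B \<open>d \<in> D\<close> assms by auto
  ultimately have "\<Squnion>B \<sqsubseteq> b \<squnion> d" using assms by (simp add: Sup_iff)
  then have "b \<squnion> d = \<top>"
    using B \<open>d \<in> carrier L\<close> assms by simp
  then show ?thesis using \<open>d \<in> D\<close> by blast
qed

lemma rather_below_directed:
  assumes "a \<in> carrier L"
  shows "{c \<in> carrier L. c \<lless> a} \<noteq> {}"
    and "\<lbrakk>x \<in> {c \<in> carrier L. c \<lless> a}; y \<in> {c \<in> carrier L. c \<lless> a}\<rbrakk>
      \<Longrightarrow> \<exists>z\<in>{c \<in> carrier L. c \<lless> a}. x \<sqsubseteq> z \<and> y \<sqsubseteq> z"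
proof -
  show "{c \<in> carrier L. c \<lless> a} \<noteq> {}" using bot_rather_below assms by auto
  assume "x \<in> {c \<in> carrier L. c \<lless> a}" "y \<in> {c \<in> carrier L. c \<lless> a}"
  then show "\<exists>z\<in>{c \<in> carrier L. c \<lless> a}. x \<sqsubseteq> z \<and> y \<sqsubseteq> z"
    using assms by (intro bexI [of _ "x \<squnion> y"]) (auto simp: rather_below_join join_left join_right)
qed

text \<open>By regularity \<open>a\<close> is the join of the elements rather below it, and these
  are directed, so relative compactness selects one of them.\<close>

lemma join_eq_top_shrink:
  assumes "a \<in> carrier L" "b \<in> carrier L" "b \<squnion> a = \<top>"
  obtains c where "c \<in> carrier L" "c \<lless> a" "b \<squnion> c = \<top>"
proof -
  have "\<exists>c\<in>{c \<in> carrier L. c \<lless> a}. b \<squnion> c = \<top>"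
    using assms regular [of a]
    by (intro compact_directed rather_below_directed) auto
  then show ?thesis using that by auto
qed

lemma not_le_witness:
  assumes "a \<in> carrier L" "b \<in> carrier L" "\<not> a \<sqsubseteq> b"
  obtains d where "d \<in> carrier L" "d \<lless> a" "\<not> d \<sqsubseteq> b"
  using assms regular [of a] Sup_iff [of "{d \<in> carrier L. d \<lless> a}" b] by auto

end

section \<open>The space $\Xi(L)$\<close>

text \<open>In the Vietoris reading, the closed sets contained in the open set \<open>a\<close>.
  Arbitrary \<open>a\<close> are allowed, whereas the generators of the topology are the boxes of
  double negations (\<open>Xi_basic_eq\<close>).\<close>

definition Box :: "'a gorder \<Rightarrow> 'a \<Rightarrow> 'a set" where
  "Box L a = {b \<in> Xi_points L. b \<squnion>\<^bsub>L\<^esub> a = \<top>\<^bsub>L\<^esub>}"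

locale krframe = compact_regular_frame L for L :: "'a gorder" (structure)
begin

lemma mem_points: "b \<in> Xi_points L \<longleftrightarrow> b \<in> carrier L \<and> b \<noteq> \<top>"
  by (simp add: Xi_points_def)

lemma points_carrier [simp]: "b \<in> Xi_points L \<Longrightarrow> b \<in> carrier L"
  by (simp add: Xi_points_def)

lemma mem_box: "b \<in> Box L a \<longleftrightarrow> b \<in> Xi_points L \<and> b \<squnion> a = \<top>"
  by (simp add: Box_def)

lemma box_subset: "Box L a \<subseteq> Xi_points L"
  by (auto simp: Box_def)

lemma Xi_basic_eq: "Xi_basic L a = Box L (neg (neg a))"
  by (auto simp: Xi_basic_def Box_def rather_below_iff)

lemma box_meet:
  assumes "a \<in> carrier L" "b \<in> carrier L" shows "Box L (a \<sqinter> b) = Box L a \<inter> Box L b"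
proof -
  have "x \<squnion> a \<sqinter> b = \<top> \<longleftrightarrow> x \<squnion> a = \<top> \<and> x \<squnion> b = \<top>" if "x \<in> carrier L" for x
    using assms that join_eq_top_mono_right [OF _ meet_left, of x a b]
      join_eq_top_mono_right [OF _ meet_right, of x a b] join_meet_eq_top [of a x b]
    by (metis meet_closed)
  then show ?thesis by (auto simp: mem_box)
qed

lemma box_mono:
  "\<lbrakk>a \<in> carrier L; b \<in> carrier L; a \<sqsubseteq> b\<rbrakk> \<Longrightarrow> Box L a \<subseteq> Box L b"
  using join_eq_top_mono_right [of _ a b] by (simp add: Box_def subset_iff)

lemma box_top: "Box L \<top> = Xi_points L"
  by (auto simp: mem_box join_comm [of L _ \<top>])

lemma box_bot: "Box L \<bottom> = {}"
proof -
  have "b \<squnion> \<bottom> = b" if "b \<in> carrier L" for b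
    using that le_iff_meet [of \<bottom> b] by (simp add: join_comm [of L b \<bottom>])
  then show ?thesis by (auto simp: mem_box mem_points)
qed

lemma box_upward:
  "\<lbrakk>a \<in> carrier L; b \<in> Box L a; c \<in> Xi_points L; b \<sqsubseteq> c\<rbrakk> \<Longrightarrow> c \<in> Box L a"
  by (auto simp: mem_box intro: join_eq_top_mono [of a b])

lemma box_shrink:
  assumes "a \<in> carrier L" "b \<in> Box L a"
  obtains c where "c \<in> carrier L" "c \<lless> a" "b \<in> Box L c"
  using assms join_eq_top_shrink [of a b] by (auto simp: mem_box)

text \<open>Boxes are closed under binary intersection, so the generated topology has them as a
  base. That every box is open needs shrinking: for \<open>c \<lless> a\<close> the generator
  \<open>Box L (neg (neg c))\<close> lies between \<open>Box L c\<close> and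
  \<open>Box L a\<close>.\<close>

lemma openin_Xi:
  "openin (Xi L) U \<longleftrightarrow> U \<subseteq> Xi_points L \<and> (\<forall>b\<in>U. \<exists>a\<in>carrier L. b \<in> Box L a \<and> Box L a \<subseteq> U)"
    (is "_ \<longleftrightarrow> ?P U")
proof
  assume "openin (Xi L) U"
  then have "generate_topology_on (Xi_basic L ` carrier L) U"
    by (simp add: Xi_def openin_topology_generated_by)
  then show "?P U"
  proof induction
    case (Int U V)
    show ?case
    proof (intro conjI ballI)
      fix b assume "b \<in> U \<inter> V"
      then obtain a a' where "a \<in> carrier L" "a' \<in> carrier L" "b \<in> Box L a" "b \<in> Box L a'"
        "Box L a \<subseteq> U" "Box L a' \<subseteq> V"
        using Int by blast
      then show "\<exists>a\<in>carrier L. b \<in> Box L a \<and> Box L a \<subseteq> U \<inter> V"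
        by (intro bexI [of _ "a \<sqinter> a'"]) (auto simp: box_meet)
    qed (use Int in auto)
  next
    case (UN K)
    show ?case
    proof (intro conjI ballI)
      fix b assume "b \<in> \<Union>K"
      then obtain V where V: "b \<in> V" "V \<in> K" by blast
      then obtain a where "a \<in> carrier L" "b \<in> Box L a" "Box L a \<subseteq> V" using UN.IH by blast
      then show "\<exists>a\<in>carrier L. b \<in> Box L a \<and> Box L a \<subseteq> \<Union>K" using V by blast
    qed (use UN.IH in blast)
  next
    case (Basis s)
    then show ?case by (auto simp: Xi_basic_eq mem_box)
  qed auto
next
  assume U: "?P U"
  have "U = \<Union>{V \<in> Xi_basic L ` carrier L. V \<subseteq> U}"
  proof (intro subset_antisym subsetI)
    fix b assume "b \<in> U"
    then obtain a where a: "a \<in> carrier L" "b \<in> Box L a" "Box L a \<subseteq> U" using U by blast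
    then obtain c where c: "c \<in> carrier L" "c \<lless> a" "b \<in> Box L c" using box_shrink by blast
    then have "b \<in> Xi_basic L c" "Xi_basic L c \<subseteq> U"
      using a box_mono [of c "neg (neg c)"] box_mono [of "neg (neg c)" a]
      by (auto simp: Xi_basic_eq le_neg_neg neg_neg_le_if_rather_below)
    then show "b \<in> \<Union>{V \<in> Xi_basic L ` carrier L. V \<subseteq> U}" using c by auto
  qed auto
  moreover have "openin (Xi L) (\<Union>{V \<in> Xi_basic L ` carrier L. V \<subseteq> U})"
    by (rule openin_Union) (auto simp: Xi_def intro: topology_generated_by_Basis)
  ultimately show "openin (Xi L) U" by simp
qed

lemma openin_XiE:
  assumes "openin (Xi L) U" "b \<in> U"
  obtains a where "a \<in> carrier L" "b \<in> Box L a" "Box L a \<subseteq> U"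
  using assms unfolding openin_Xi by meson

lemma openin_box: "a \<in> carrier L \<Longrightarrow> openin (Xi L) (Box L a)"
  using box_subset by (auto simp: openin_Xi)

lemma topspace_Xi [simp]: "topspace (Xi L) = Xi_points L"
proof
  show "topspace (Xi L) \<subseteq> Xi_points L"
    using openin_Xi openin_topspace by blast
  show "Xi_points L \<subseteq> topspace (Xi L)"
    using openin_box [of \<top>] openin_subset by (fastforce simp: box_top)
qed

text \<open>If \<open>\<not> b \<sqsubseteq> c\<close>, regularity gives \<open>d \<lless> b\<close>
  with \<open>\<not> d \<sqsubseteq> c\<close>. The box of \<open>neg d\<close> contains
  \<open>b\<close>, and it misses \<open>c\<close> because
  \<open>c \<squnion> neg d = \<top>\<close> would force \<open>d \<sqsubseteq> c\<close>.\<close>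

lemma spec_le_Xi: "spec_le (Xi L) b c \<longleftrightarrow> b \<in> Xi_points L \<and> c \<in> Xi_points L \<and> b \<sqsubseteq> c"
proof -
  have "\<exists>U. openin (Xi L) U \<and> b \<in> U \<and> c \<notin> U"
    if bc: "b \<in> Xi_points L" "c \<in> Xi_points L" "\<not> b \<sqsubseteq> c"
  proof -
    obtain d where d: "d \<in> carrier L" "d \<lless> b" "\<not> d \<sqsubseteq> c"
      using bc not_le_witness points_carrier by metis
    then have "b \<in> Box L (neg d)" using bc by (simp add: mem_box rather_below_iff)
    moreover have "c \<notin> Box L (neg d)"
      using bc(2) d le_of_join_eq_top [of d "neg d" c] meet_neg [of d] neg_closed [of d] points_carrier
      unfolding mem_box by metis
    ultimately show ?thesis using openin_box by (meson neg_closed)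
  qed
  moreover have "c \<in> U" if U: "openin (Xi L) U" "b \<in> U" "c \<in> Xi_points L" "b \<sqsubseteq> c" for U
  proof -
    obtain a where "a \<in> carrier L" "b \<in> Box L a" "Box L a \<subseteq> U"
      using openin_XiE [OF U(1,2)] .
    then show ?thesis using box_upward [of a b c] U by blast
  qed
  ultimately show ?thesis unfolding spec_le_def topspace_Xi by blast
qed

section \<open>Order-regular and regular open sets of \<open>Xi L\<close>\<close>

text \<open>The box of \<open>core U\<close> is in general larger than \<open>U\<close>. For a
  discrete space of two points, the two singletons form an open set of closed sets whose core is the
  whole space, and the box of the core also contains the pair.\<close>

definition core :: "'a set \<Rightarrow> 'a" where
  "core U = \<Squnion>{a \<in> carrier L. Box L a \<subseteq> U}"

lemma core_closed [simp]: "core U \<in> carrier L"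
  unfolding core_def by (rule sup_closed) auto

lemma core_le_iff: "c \<in> carrier L \<Longrightarrow> core U \<sqsubseteq> c \<longleftrightarrow> (\<forall>a\<in>carrier L. Box L a \<subseteq> U \<longrightarrow> a \<sqsubseteq> c)"
  unfolding core_def by (subst Sup_iff) auto

text \<open>In the Vietoris reading: a closed set meets the open set \<open>a\<close> iff it has a
  nonempty closed subset inside \<open>a\<close>. Regularity supplies the subset.\<close>

lemma down_box:
  assumes a: "a \<in> carrier L" shows "down (Xi L) (Box L a) = {b \<in> Xi_points L. \<not> a \<sqsubseteq> b}"
proof (intro subset_antisym subsetI)
  fix b assume "b \<in> down (Xi L) (Box L a)"
  then obtain c where c: "b \<in> Xi_points L" "c \<in> Xi_points L" "b \<sqsubseteq> c" "c \<squnion> a = \<top>"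
    by (auto simp: down_def spec_le_Xi mem_box)
  have "\<not> a \<sqsubseteq> b"
  proof
    assume "a \<sqsubseteq> b"
    then have "a \<sqsubseteq> c" using a c by (meson le_trans points_carrier)
    then have "\<top> \<sqsubseteq> c" using a c iffD2 [OF join_iff, of c a c] by simp
    then show False using c by (auto simp: mem_points)
  qed
  then show "b \<in> {b \<in> Xi_points L. \<not> a \<sqsubseteq> b}" using c by simp
next
  fix b assume "b \<in> {b \<in> Xi_points L. \<not> a \<sqsubseteq> b}"
  then have b: "b \<in> Xi_points L" "\<not> a \<sqsubseteq> b" by auto
  then obtain d where d: "d \<in> carrier L" "d \<lless> a" "\<not> d \<sqsubseteq> b"
    using a not_le_witness points_carrier by metis
  \<comment> \<open>Joining \<open>neg d\<close> shrinks the closed set \<open>b\<close> until it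
    lies in \<open>a\<close>, since \<open>a \<squnion> neg d = \<top>\<close>. It stays nonempty,
    because \<open>b \<squnion> neg d = \<top>\<close> would give
    \<open>d \<sqsubseteq> b\<close>.\<close>
  let ?c = "b \<squnion> neg d"
  have "?c \<noteq> \<top>"
    using b d le_of_join_eq_top [of d "neg d" b] by (auto simp: meet_neg)
  moreover have "?c \<squnion> a = \<top>"
    using a b d join_eq_top_mono [of "neg d" a a ?c]
    by (auto simp: rather_below_iff join_comm [of L a "neg d"] join_comm [of L a ?c] join_right
        intro: join_eq_top_mono [of a "neg d"])
  ultimately show "b \<in> down (Xi L) (Box L a)"
    using b by (auto simp: down_def spec_le_Xi mem_box mem_points join_left intro!: bexI [of _ ?c])
qed

lemma down_open:
  assumes "openin (Xi L) U" shows "down (Xi L) U = {b \<in> Xi_points L. \<not> core U \<sqsubseteq> b}"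
proof -
  have "down (Xi L) U = (\<Union>a\<in>{a \<in> carrier L. Box L a \<subseteq> U}. down (Xi L) (Box L a))"
    using assms unfolding openin_Xi down_def by blast
  also have "\<dots> = {b \<in> Xi_points L. \<not> core U \<sqsubseteq> b}"
    by (auto simp: core_le_iff down_box)
  finally show ?thesis .
qed

lemma Int_le_down_open:
  assumes "openin (Xi L) U" shows "Int_le (Xi L) (down (Xi L) U) = Box L (core U)"
proof (intro subset_antisym subsetI)
  fix b assume "b \<in> Int_le (Xi L) (down (Xi L) U)"
  then have b: "b \<in> Xi_points L" "\<And>c. c \<in> Xi_points L \<Longrightarrow> b \<sqsubseteq> c \<Longrightarrow> \<not> core U \<sqsubseteq> c"
    by (auto simp: Int_le_def spec_le_Xi down_open [OF assms])
  \<comment> \<open>The join is the least candidate for a point above \<open>b\<close> that lies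
    outside the down-set; it fails to be a point only by being \<open>\<top>\<close>.\<close>
  have "b \<squnion> core U = \<top>"
    using b(2) [of "b \<squnion> core U"] b(1) by (auto simp: mem_points join_left join_right)
  then show "b \<in> Box L (core U)" using b by (simp add: mem_box)
next
  fix b assume b: "b \<in> Box L (core U)"
  have "\<not> core U \<sqsubseteq> c" if c: "c \<in> Xi_points L" "b \<sqsubseteq> c" for c
  proof
    assume "core U \<sqsubseteq> c"
    then have "\<top> \<sqsubseteq> c" using b c iffD2 [OF join_iff, of b "core U" c] by (simp add: mem_box)
    then show False using b c by (auto simp: mem_box mem_points)
  qed
  then show "b \<in> Int_le (Xi L) (down (Xi L) U)"
    using b by (auto simp: Int_le_def mem_box spec_le_Xi down_open [OF assms])
qed

lemma box_subset_iff:
  assumes "a \<in> carrier L" "b \<in> carrier L" shows "Box L a \<subseteq> Box L b \<longleftrightarrow> a \<sqsubseteq> b"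
proof
  assume "Box L a \<subseteq> Box L b"
  then have "down (Xi L) (Box L a) \<subseteq> down (Xi L) (Box L b)" by (auto simp: down_def)
  \<comment> \<open>Evaluate at the point \<open>b\<close>: it is outside the down-set of its own
    box, hence outside that of \<open>Box L a\<close>. If \<open>b = \<top>\<close> there is nothing
    to prove.\<close>
  then show "a \<sqsubseteq> b"
    using assms by (cases "b = \<top>") (auto simp: down_box mem_points)
qed (use assms box_mono in auto)

lemma core_box: assumes "a \<in> carrier L" shows "core (Box L a) = a"
proof (rule le_antisym)
  show "core (Box L a) \<sqsubseteq> a" using assms by (simp add: core_le_iff box_subset_iff)
  show "a \<sqsubseteq> core (Box L a)" unfolding core_def using assms by (intro sup_upper) auto
qed (use assms in auto)

lemma box_in_order_RO: "a \<in> carrier L \<Longrightarrow> Box L a \<in> order_RO (Xi L)"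
  using box_subset by (auto simp: order_RO_def Int_le_down_open openin_box core_box)

text \<open>Two boxes are disjoint iff their elements meet in \<open>\<bottom>\<close>, so a box
  misses \<open>U\<close> iff its element is disjoint from every element contributing to
  \<open>core U\<close>.\<close>

lemma perp_open:
  assumes "openin (Xi L) U" shows "perp (Xi L) U = Box L (neg (core U))"
proof (intro subset_antisym subsetI)
  fix b assume b: "b \<in> perp (Xi L) U"
  then obtain V where "openin (Xi L) V" "b \<in> V" "V \<inter> U = {}"
    unfolding perp_def closure_of_def by auto
  then obtain v where v: "v \<in> carrier L" "b \<in> Box L v" "Box L v \<inter> U = {}"
    unfolding openin_Xi by blast
  have "u \<sqsubseteq> neg v" if "u \<in> carrier L" "Box L u \<subseteq> U" for u
  proof -
    have "Box L (v \<sqinter> u) \<subseteq> Box L \<bottom>" using v that by (auto simp: box_meet box_bot)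
    then show ?thesis using v that by (simp add: box_subset_iff le_neg_iff)
  qed
  then have "core U \<sqsubseteq> neg v" by (simp add: core_le_iff)
  then have "v \<sqsubseteq> neg (core U)" using v by (simp add: le_neg_iff meet_comm)
  then show "b \<in> Box L (neg (core U))"
    using v box_mono [of v "neg (core U)"] by auto
next
  fix b assume b: "b \<in> Box L (neg (core U))"
  have "Box L (neg (core U)) \<inter> U = {}"
  proof -
    have False if c: "c \<in> Box L (neg (core U))" "c \<in> U" for c
    proof -
      obtain u where u: "u \<in> carrier L" "c \<in> Box L u" "Box L u \<subseteq> U"
        using c assms unfolding openin_Xi by blast
      then have "u \<sqsubseteq> core U" unfolding core_def by (intro sup_upper) auto
      then have "c \<in> Box L (neg (core U) \<sqinter> core U)"
        using u c box_mono [of u "core U"] by (auto simp: box_meet)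
      then show False by (simp add: meet_comm [of L "neg (core U)"] meet_neg box_bot)
    qed
    then show ?thesis by blast
  qed
  then show "b \<in> perp (Xi L) U"
    using b openin_box [of "neg (core U)"] box_subset
    by (fastforce simp: perp_def closure_of_def)
qed

lemma RO_Xi: "RO (Xi L) = (\<lambda>a. Box L (neg a)) ` carrier L"
proof (intro subset_antisym subsetI)
  fix U assume "U \<in> RO (Xi L)"
  then have "U = Box L (neg (core (perp (Xi L) U)))"
    using perp_open [OF openin_perp] by (metis RO_perp_perp)
  then show "U \<in> (\<lambda>a. Box L (neg a)) ` carrier L" by auto
next
  fix U assume "U \<in> (\<lambda>a. Box L (neg a)) ` carrier L"
  then obtain a where "a \<in> carrier L" "U = Box L (neg a)" by auto
  then have "perp (Xi L) (perp (Xi L) U) = U"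
    by (simp add: perp_open openin_box core_box neg_neg_neg)
  then show "U \<in> RO (Xi L)"
    using \<open>U = _\<close> box_subset by (simp add: RO_def)
qed

lemma box_neg_in_RO: "a \<in> carrier L \<Longrightarrow> Box L (neg a) \<in> RO (Xi L)"
  by (simp add: RO_Xi)

lemma RO_XiE:
  assumes "U \<in> RO (Xi L)"
  obtains a where "a \<in> carrier L" "neg (neg a) = a" "U = Box L a"
proof -
  obtain c where "c \<in> carrier L" "U = Box L (neg c)" using assms by (auto simp: RO_Xi)
  then show ?thesis by (intro that [of "neg c"]) (simp_all add: neg_neg_neg)
qed

lemma closure_of_box:
  assumes "a \<in> carrier L"
  shows "Xi L closure_of (Box L a) = {b \<in> Xi_points L. b \<squnion> neg a \<noteq> \<top>}"
proof -
  have "Xi_points L - Xi L closure_of (Box L a) = Box L (neg a)"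
    using assms perp_open [OF openin_box, of a] by (simp add: perp_def core_box)
  then have "Xi L closure_of (Box L a) = Xi_points L - Box L (neg a)"
    using closure_of_subset_topspace [of "Xi L" "Box L a"] topspace_Xi by blast
  then show ?thesis by (simp add: Box_def set_diff_eq cong: conj_cong)
qed

text \<open>The inclusion of the closure has to be tested on the points above \<open>c\<close>. The
  smallest of them is \<open>c\<close> itself, unless \<open>c = \<top>\<close>, and there the test
  is \<open>c \<squnion> neg a = \<top>\<close>.\<close>

lemma way_inside_box:
  assumes "a \<in> carrier L" "c \<in> carrier L"
  shows "way_inside (Xi L) (Box L a) (Box L c) \<longleftrightarrow> a \<lless> c"
proof
  assume "way_inside (Xi L) (Box L a) (Box L c)"
  then have *: "b \<squnion> neg a = \<top>" if "b \<in> Xi_points L" "c \<sqsubseteq> b" for b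
    using assms that by (auto simp: way_inside_def closure_of_box down_box)
  show "a \<lless> c"
  proof (cases "c = \<top>")
    case False
    then show ?thesis using * [of c] assms by (simp add: mem_points rather_below_iff)
  qed (use assms in \<open>simp add: rather_below_iff\<close>)
next
  assume "a \<lless> c"
  then have "b \<squnion> neg a = \<top>" if "b \<in> Xi_points L" "c \<sqsubseteq> b" for b
    using that assms join_eq_top_mono [of "neg a" c "neg a" b] by (simp add: rather_below_iff)
  then show "way_inside (Xi L) (Box L a) (Box L c)"
    using assms by (auto simp: way_inside_def closure_of_box down_box)
qed

section \<open>Well-roundedness and the conditions defining a dV-space\<close>

text \<open>The points outside the down-set of the box are those above \<open>a\<close>, so
  separating \<open>C\<close> from all of them amounts to separating \<open>C\<close> from the
  single point \<open>a\<close>.\<close>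

lemma well_rounded_box:
  assumes a: "a \<in> carrier L" shows "well_rounded (Xi L) (Box L a)"
  unfolding well_rounded_def
proof (intro conjI allI impI openin_box a)
  fix C assume C: "closedin (Xi L) C \<and> C \<subseteq> down (Xi L) (Box L a)"
  show "\<exists>W1 W2. openin (Xi L) W1 \<and> openin (Xi L) W2 \<and> W1 \<inter> W2 = {} \<and>
    C \<subseteq> down (Xi L) W1 \<and> topspace (Xi L) - W2 \<subseteq> down (Xi L) (Box L a)"
  proof (cases "a = \<top>")
    case True
    then have "Xi_points L \<subseteq> down (Xi L) (Box L a)"
      by (simp add: box_top subset_down)
    then show ?thesis
      using C a by (intro exI [of _ "Box L a"] exI [of _ "{}"]) (simp add: openin_box)
  next
    case False
    then have "a \<in> topspace (Xi L) - C" using a C by (auto simp: mem_points down_box)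
    moreover have "openin (Xi L) (topspace (Xi L) - C)" using C by blast
    ultimately obtain u where u: "u \<in> carrier L" "a \<in> Box L u" "Box L u \<subseteq> topspace (Xi L) - C"
      using openin_XiE by metis
    \<comment> \<open>Shrinking \<open>u\<close> to \<open>w\<close> leaves room for two disjoint
      boxes: that of \<open>w\<close> still contains \<open>a\<close>, and that of
      \<open>neg w\<close> has a down-set containing every point outside
      \<open>Box L u\<close>.\<close>
    then obtain w where w: "w \<in> carrier L" "w \<lless> u" "a \<in> Box L w" using box_shrink by metis
    have "Box L (neg w) \<inter> Box L w = {}"
      using w by (simp add: box_bot meet_comm [of L "neg w"] meet_neg flip: box_meet)
    moreover have "C \<subseteq> down (Xi L) (Box L (neg w))"
    proof
      fix b assume "b \<in> C"
      then have b: "b \<in> Xi_points L" "b \<notin> Box L u" using C u closedin_subset topspace_Xi by blast+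
      have "\<not> neg w \<sqsubseteq> b"
      proof
        assume "neg w \<sqsubseteq> b"
        then have "b \<squnion> u = \<top>"
          using u w b join_eq_top_mono_right [of u "neg w" b]
          by (simp add: rather_below_iff join_comm [of L b u])
        then show False using b by (simp add: mem_box)
      qed
      then show "b \<in> down (Xi L) (Box L (neg w))" using b by (simp add: down_box)
    qed
    moreover have "topspace (Xi L) - Box L w \<subseteq> down (Xi L) (Box L a)"
    proof
      fix b assume "b \<in> topspace (Xi L) - Box L w"
      then show "b \<in> down (Xi L) (Box L a)"
        using a w join_eq_top_mono [of w a w b] by (auto simp: down_box mem_box)
    qed
    ultimately show ?thesis
      using w by (intro exI [of _ "Box L (neg w)"] exI [of _ "Box L w"]) (simp add: openin_box)
  qed
qed

text \<open>The complement of a regular closed \<open>B\<close> is the exterior of its interior,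
  hence a box, and \<open>Int_le B\<close> is the complement of the down-set of that box.
  Order-normality thus reduces to well-roundedness of the box.\<close>

lemma order_normal_Xi: "order_normal (Xi L)"
  unfolding order_normal_def
proof (intro allI impI)
  fix A B
  assume AB: "closedin (Xi L) A \<and> regular_closedin (Xi L) B \<and> A \<inter> Int_le (Xi L) B = {}"
  define e where "e = neg (core (Xi L interior_of B))"
  have "B \<subseteq> topspace (Xi L)" "topspace (Xi L) - B = Box L e"
    using AB perp_open [of "Xi L interior_of B"]
    by (auto simp: regular_closedin_def perp_def e_def)
  then have "B = topspace (Xi L) - Box L e" by blast
  then have B: "Int_le (Xi L) B = topspace (Xi L) - down (Xi L) (Box L e)"
    by (simp only: Int_le_diff)
  then have "A \<subseteq> down (Xi L) (Box L e)" using AB closedin_subset by fastforce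
  moreover have "well_rounded (Xi L) (Box L e)" by (simp add: e_def well_rounded_box)
  ultimately obtain W1 W2 where "openin (Xi L) W1" "openin (Xi L) W2" "W1 \<inter> W2 = {}"
    "A \<subseteq> down (Xi L) W1" "topspace (Xi L) - W2 \<subseteq> down (Xi L) (Box L e)"
    using AB unfolding well_rounded_def by meson
  then show "\<exists>U W. openin (Xi L) U \<and> openin (Xi L) W \<and> U \<inter> W = {} \<and>
      A \<subseteq> down (Xi L) U \<and> Int_le (Xi L) B \<subseteq> W"
    using B by (intro exI [of _ W1] exI [of _ W2]) auto
qed

lemma t0_space_Xi: "t0_space (Xi L)"
  unfolding t0_space_def
proof (intro ballI impI)
  fix b c assume bc: "b \<in> topspace (Xi L)" "c \<in> topspace (Xi L)" "b \<noteq> c"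
  then have "\<not> spec_le (Xi L) b c \<or> \<not> spec_le (Xi L) c b"
    using le_antisym by (auto simp: spec_le_Xi)
  then show "\<exists>U. openin (Xi L) U \<and> (b \<notin> U) = (c \<in> U)"
    using bc unfolding spec_le_def by blast
qed

text \<open>\<open>\<bottom>\<close> is the least point, so an open set containing it is the whole
  space. In the trivial frame \<open>\<bottom>\<close> is not a point, and the space is
  empty.\<close>

lemma compact_space_Xi: "compact_space (Xi L)"
proof (cases "\<bottom> = \<top>")
  case True
  then have "topspace (Xi L) = {}"
    using bottom_lower top_le_iff by (metis mem_points topspace_Xi equals0I)
  then show ?thesis by (simp add: compact_space_def)
next
  case False
  show ?thesis
    unfolding compact_space_alt
  proof (intro allI impI)
    fix K assume K: "(\<forall>U\<in>K. openin (Xi L) U) \<and> topspace (Xi L) \<subseteq> \<Union>K"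
    have bot: "\<bottom> \<in> Xi_points L" using False by (simp add: mem_points)
    then obtain U where U: "U \<in> K" "\<bottom> \<in> U" using K by auto
    have "b \<in> U" if "b \<in> Xi_points L" for b
      using that bot U K by (intro spec_le_openin [of "Xi L" \<bottom> b U]) (auto simp: spec_le_Xi)
    then show "\<exists>F. finite F \<and> F \<subseteq> K \<and> topspace (Xi L) \<subseteq> \<Union>F"
      using U by (intro exI [of _ "{U}"]) auto
  qed
qed

lemma openin_Xi_RO: "openin (Xi L) = arbitrary union_of (\<lambda>U. U \<in> RO (Xi L))"
proof
  fix U
  have "openin (Xi L) U \<longleftrightarrow> (\<forall>b\<in>U. \<exists>V. V \<in> RO (Xi L) \<and> b \<in> V \<and> V \<subseteq> U)"
  proof
    assume U: "openin (Xi L) U"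
    show "\<forall>b\<in>U. \<exists>V. V \<in> RO (Xi L) \<and> b \<in> V \<and> V \<subseteq> U"
    proof
      fix b assume "b \<in> U"
      then obtain a where a: "a \<in> carrier L" "b \<in> Box L a" "Box L a \<subseteq> U"
        using U openin_XiE by metis
      then obtain c where c: "c \<in> carrier L" "c \<lless> a" "b \<in> Box L c" using box_shrink by metis
      have "Box L c \<subseteq> Box L (neg (neg c))" "Box L (neg (neg c)) \<subseteq> Box L a"
        using a c by (auto simp: box_subset_iff le_neg_neg neg_neg_le_if_rather_below)
      then show "\<exists>V. V \<in> RO (Xi L) \<and> b \<in> V \<and> V \<subseteq> U"
        using a c by (intro exI [of _ "Box L (neg (neg c))"]) (auto simp: box_neg_in_RO)
    qed
  next
    assume "\<forall>b\<in>U. \<exists>V. V \<in> RO (Xi L) \<and> b \<in> V \<and> V \<subseteq> U"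
    then show "openin (Xi L) U" using openin_subopen RO_openin by metis
  qed
  then show "openin (Xi L) U = (arbitrary union_of (\<lambda>U. U \<in> RO (Xi L))) U"
    by (simp add: arbitrary_union_of_alt)
qed

lemma RO_at_concordant:
  assumes x: "x \<in> topspace (Xi L)" shows "concordant_filter (Xi L) (RO_at (Xi L) x)"
  unfolding concordant_filter_def
proof (intro conjI ballI)
  show "RO_filter (Xi L) (RO_at (Xi L) x)"
  proof -
    have "topspace (Xi L) \<in> RO_at (Xi L) x" using x topspace_in_RO [of "Xi L"] by (auto simp: RO_at_def)
    then show ?thesis using RO_Int unfolding RO_filter_def RO_at_def by blast
  qed
  fix U assume U: "U \<in> RO_at (Xi L) x"
  then have "U \<in> RO (Xi L)" "x \<in> U" by (auto simp: RO_at_def)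
  then obtain a where a: "a \<in> carrier L" "U = Box L a" "x \<in> Box L a" using RO_XiE by metis
  then obtain c where c: "c \<in> carrier L" "c \<lless> a" "x \<in> Box L c" using box_shrink by metis
  have "Box L c \<subseteq> Box L (neg (neg c))" using c by (simp add: box_mono le_neg_neg)
  \<comment> \<open>Triple negation collapses, so replacing \<open>c\<close> by the regular element
    \<open>neg (neg c)\<close> does not change what it is rather below.\<close>
  moreover have "neg (neg c) \<lless> a"
    using c by (simp add: rather_below_iff neg_neg_neg)
  ultimately show "\<exists>W\<in>RO_at (Xi L) x. way_inside (Xi L) W U"
    using a c by (intro bexI [of _ "Box L (neg (neg c))"])
      (auto simp: RO_at_def box_neg_in_RO way_inside_box)
qed

text \<open>In terms of closed sublocales, the point attached to a filter is the intersection of the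
  closures of its members.\<close>

lemma filter_point:
  assumes F: "RO_filter (Xi L) F"
  shows "\<exists>x\<in>topspace (Xi L). {U \<in> F. \<exists>W\<in>F. way_inside (Xi L) W U} = RO_at (Xi L) x"
proof -
  define G where "G = {w \<in> carrier L. Box L w \<in> F}"
  define x where "x = \<Squnion>(neg ` G)"
  have negG: "neg ` G \<subseteq> carrier L" by auto
  then have xc: "x \<in> carrier L" unfolding x_def by (rule sup_closed)
  have ROF: "U \<in> RO (Xi L)" if "U \<in> F" for U using F that by (auto simp: RO_filter_def)
  have FE: "\<exists>w\<in>G. U = Box L w" if "U \<in> F" for U
    using that ROF RO_XiE unfolding G_def by (metis (mono_tags, lifting) mem_Collect_eq)
  have upF: "Box L a \<in> F" if "w \<in> G" "w \<sqsubseteq> a" "Box L a \<in> RO (Xi L)" "a \<in> carrier L" for a w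
  proof -
    have "Box L w \<subseteq> Box L a" "Box L w \<in> F" using that by (auto simp: G_def box_mono)
    then show ?thesis using F that unfolding RO_filter_def by blast
  qed
  have dir: "\<exists>z\<in>neg ` G. y \<sqsubseteq> z \<and> y' \<sqsubseteq> z" if "y \<in> neg ` G" "y' \<in> neg ` G" for y y'
  proof -
    obtain w w' where w: "w \<in> G" "w' \<in> G" "y = neg w" "y' = neg w'" using \<open>y \<in> _\<close> \<open>y' \<in> _\<close> by auto
    then have "w \<sqinter> w' \<in> G" using F by (auto simp: G_def box_meet RO_filter_def)
    moreover have "neg w \<sqsubseteq> neg (w \<sqinter> w')" "neg w' \<sqsubseteq> neg (w \<sqinter> w')"
      using w by (auto simp: G_def intro!: neg_antimono meet_left meet_right)
    ultimately show ?thesis using w by blast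
  qed
  have ne: "neg ` G \<noteq> {}" using F FE by (auto simp: RO_filter_def)
  \<comment> \<open>Compactness turns a cover by the join \<open>x\<close> into a cover by one
    \<open>neg w\<close>, and \<open>a \<squnion> neg w = \<top>\<close> means
    \<open>w \<lless> a\<close>. So neighbourhoods of \<open>x\<close> correspond to elements with a
    member of the filter rather below them.\<close>
  have cover: "x \<squnion> a = \<top> \<longleftrightarrow> (\<exists>w\<in>G. w \<lless> a)" if a: "a \<in> carrier L" for a
  proof
    assume "x \<squnion> a = \<top>"
    then have "a \<squnion> \<Squnion>(neg ` G) = \<top>" by (simp add: x_def join_comm)
    then show "\<exists>w\<in>G. w \<lless> a"
      using compact_directed [OF a negG ne dir] by (auto simp: rather_below_iff)
  next
    assume "\<exists>w\<in>G. w \<lless> a"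
    then obtain w where w: "w \<in> G" "a \<squnion> neg w = \<top>" by (auto simp: rather_below_iff)
    have "neg w \<sqsubseteq> x" unfolding x_def using w negG by (intro sup_upper) auto
    then show "x \<squnion> a = \<top>"
      using w a xc join_eq_top_mono_right [of a "neg w" x] by (simp add: join_comm)
  qed
  have "x \<noteq> \<top>"
  proof
    assume "x = \<top>"
    \<comment> \<open>If \<open>x\<close> were \<open>\<top>\<close>, then \<open>cover\<close> at
      \<open>a = \<bottom>\<close> would put the empty box into the proper filter
      \<open>F\<close>.\<close>
    then obtain w where w: "w \<in> G" "w \<lless> \<bottom>" using cover [of \<bottom>] by auto
    then have "w = \<bottom>" using rather_below_le [of w \<bottom>] by (auto simp: G_def)
    then show False using w F by (simp add: G_def RO_filter_def box_bot)
  qed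
  then have xp: "x \<in> topspace (Xi L)" using xc by (simp add: mem_points)
  have "{U \<in> F. \<exists>W\<in>F. way_inside (Xi L) W U} = RO_at (Xi L) x"
  proof (intro subset_antisym subsetI)
    fix U assume "U \<in> {U \<in> F. \<exists>W\<in>F. way_inside (Xi L) W U}"
    then obtain W where W: "U \<in> F" "W \<in> F" "way_inside (Xi L) W U" by blast
    obtain u where "u \<in> G" "U = Box L u" using FE W by blast
    moreover obtain w where "w \<in> G" "W = Box L w" using FE W by blast
    moreover note W
    ultimately
    show "U \<in> RO_at (Xi L) x"
      using xp ROF cover [of u] by (auto simp: G_def way_inside_box RO_at_def mem_box)
  next
    fix U assume "U \<in> RO_at (Xi L) x"
    then have U: "U \<in> RO (Xi L)" "x \<in> U" by (auto simp: RO_at_def)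
    then obtain a where "a \<in> carrier L" "U = Box L a" using RO_XiE by metis
    then have a: "a \<in> carrier L" "U = Box L a" "x \<squnion> a = \<top>" "U \<in> RO (Xi L)"
      using U by (auto simp: mem_box)
    then obtain w where w: "w \<in> G" "w \<lless> a" using cover by auto
    then have wc: "w \<in> carrier L" "Box L w \<in> F" by (auto simp: G_def)
    then have "U \<in> F" using w a upF [of w a] by (simp add: rather_below_le)
    then show "U \<in> {U \<in> F. \<exists>W\<in>F. way_inside (Xi L) W U}"
      using w a wc by (auto simp: way_inside_box intro!: bexI [of _ "Box L w"])
  qed
  then show ?thesis using xp by blast
qed

theorem dV_space_Xi: "dV_space (Xi L)"
proof -
  have "RO (Xi L) \<subseteq> order_RO (Xi L)"
    by (auto simp: RO_Xi box_in_order_RO)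
  then show ?thesis
    unfolding dV_space_def
    using t0_space_Xi compact_space_Xi order_normal_Xi openin_Xi_RO RO_at_concordant filter_point
    by blast
qed

end

section \<open>The frame of a $dV$-space\<close>

locale dV =
  fixes X :: "'a topology"
  assumes dV: "dV_space X"
begin

lemma RO_order_RO: "U \<in> RO X \<Longrightarrow> U \<in> order_RO X"
  using dV by (auto simp: dV_space_def)

lemma ohull_RO: "U \<in> RO X \<Longrightarrow> ohull X U = U"
  using RO_order_RO by (simp add: order_RO_iff_ohull)

lemma RO_base:
  assumes "openin X U" "x \<in> U"
  obtains V where "V \<in> RO X" "x \<in> V" "V \<subseteq> U"
proof -
  have "(arbitrary union_of (\<lambda>U. U \<in> RO X)) U"
    using dV assms(1) by (simp add: dV_space_def)
  then show ?thesis using assms(2) that by (auto simp: arbitrary_union_of_alt)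
qed

lemma RO_shrink:
  assumes "U \<in> RO X" "x \<in> U"
  obtains W where "W \<in> RO X" "x \<in> W" "way_inside X W U"
proof -
  have "x \<in> topspace X" using assms RO_subset by blast
  then have "\<forall>U\<in>RO_at X x. \<exists>W\<in>RO_at X x. way_inside X W U"
    using dV by (simp add: dV_space_def concordant_filter_def)
  then show ?thesis using assms that by (auto simp: RO_at_def)
qed

lemma filter_limit:
  "RO_filter X F \<Longrightarrow> \<exists>x\<in>topspace X. {U \<in> F. \<exists>W\<in>F. way_inside X W U} = RO_at X x"
  using dV by (simp add: dV_space_def)

text \<open>The definition only gives \<open>U \<subseteq> down X W\<close>; order-regularity of
  both sets removes the \<open>down\<close>.\<close>

lemma way_inside_subset:
  assumes "U \<in> RO X" "W \<in> RO X" "way_inside X U W" shows "U \<subseteq> W"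
proof -
  have "U \<subseteq> X closure_of U" using assms(1) by (simp add: RO_subset closure_of_subset)
  then have "ohull X U \<subseteq> Int_le X (down X (down X W))"
    using assms unfolding way_inside_def ohull_def by (intro Int_le_mono down_mono) simp
  then show ?thesis using assms ohull_RO by (simp add: down_down ohull_def)
qed

text \<open>A point outside the order-regular set \<open>W\<close> has a point above it outside
  \<open>down X W\<close>. That point is outside the closure of \<open>U\<close>, that is, in
  \<open>perp X U\<close>.\<close>

lemma way_inside_perp:
  assumes "U \<in> RO X" "W \<in> RO X" "way_inside X U W"
  shows "way_inside X (perp X W) (perp X U)"
  unfolding way_inside_def closure_of_perp [OF assms(2)]
proof
  fix x assume x: "x \<in> topspace X - W"
  then have "x \<notin> ohull X W" using assms ohull_RO by blast
  then obtain y where y: "spec_le X x y" "y \<notin> down X W" using x by (auto simp: mem_ohull)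
  then have "y \<in> topspace X" using spec_leD by metis
  then have "y \<in> perp X U" using y(2) assms(3) by (auto simp: way_inside_def perp_def)
  then show "x \<in> down X (perp X U)" using y(1) by (auto simp: mem_down)
qed

text \<open>The filter of regular open sets containing the complement of \<open>down X V\<close> for some member
  \<open>V\<close> of the family yields the least such point.\<close>

lemma directed_point:
  assumes ne: "K \<noteq> {}" and op: "\<And>V. V \<in> K \<Longrightarrow> openin X V"
    and dir: "\<And>V V'. \<lbrakk>V \<in> K; V' \<in> K\<rbrakk> \<Longrightarrow> \<exists>V''\<in>K. V \<union> V' \<subseteq> V''"
    and proper: "\<And>V. V \<in> K \<Longrightarrow> down X V \<noteq> topspace X"
  obtains x where "x \<in> topspace X"
    "\<And>y. y \<in> topspace X \<Longrightarrow> spec_le X x y \<longleftrightarrow> (\<forall>V\<in>K. y \<notin> down X V)"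
proof -
  define F where "F = {U \<in> RO X. \<exists>V\<in>K. topspace X - down X V \<subseteq> U}"
  have "RO_filter X F"
    unfolding RO_filter_def
  proof (intro conjI ballI impI)
    show "F \<noteq> {}" using ne topspace_in_RO [of X] by (auto simp: F_def)
    show "{} \<notin> F" using proper down_subset unfolding F_def by fastforce
  next
    fix U W assume "U \<in> F" "W \<in> F"
    then obtain V V' where V: "U \<in> RO X" "W \<in> RO X" "V \<in> K" "V' \<in> K"
      "topspace X - down X V \<subseteq> U" "topspace X - down X V' \<subseteq> W"
      unfolding F_def by blast
    obtain V'' where V'': "V'' \<in> K" "V \<union> V' \<subseteq> V''" using dir V(3,4) by blast
    have "down X V \<subseteq> down X V''" "down X V' \<subseteq> down X V''"
      using V'' down_mono [of V V''] down_mono [of V' V''] by simp_all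
    then have "topspace X - down X V'' \<subseteq> U \<inter> W" using V by blast
    then show "U \<inter> W \<in> F" using V''(1) RO_Int [OF V(1,2)] unfolding F_def by blast
  next
    fix U W assume "U \<in> F" "W \<in> RO X" "U \<subseteq> W"
    then show "W \<in> F" unfolding F_def by blast
  qed (simp add: F_def)
  from filter_limit [OF this]
  obtain x where x: "x \<in> topspace X" "{U \<in> F. \<exists>W\<in>F. way_inside X W U} = RO_at X x"
    by (elim bexE)
  have notin: "x \<notin> down X V" if V: "V \<in> K" for V
  proof
    assume "x \<in> down X V"
    then obtain z where z: "z \<in> V" "spec_le X x z" by (auto simp: mem_down)
    obtain W where W: "W \<in> RO X" "z \<in> W" "W \<subseteq> V" by (rule RO_base [OF op [OF V] z(1)])
    \<comment> \<open>Two shrinkings are needed: \<open>perp X W2\<close> becomes a neighbourhood of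
      \<open>x\<close> only if another member of \<open>F\<close> is way inside it, and
      \<open>perp X W1\<close> is that member.\<close>
    obtain W1 where W1: "W1 \<in> RO X" "z \<in> W1" "way_inside X W1 W" by (rule RO_shrink [OF W(1,2)])
    obtain W2 where W2: "W2 \<in> RO X" "z \<in> W2" "way_inside X W2 W1" by (rule RO_shrink [OF W1(1,2)])
    have "topspace X - down X V \<subseteq> perp X W1"
      using W W1 down_mono [of W V X] by (auto simp: way_inside_def perp_def)
    moreover have "perp X W1 \<subseteq> perp X W2"
      using W1 W2 way_inside_subset by (simp add: perp_antimono)
    ultimately have "perp X W1 \<in> F" "perp X W2 \<in> F"
      using V W1 W2 by (auto simp: F_def perp_in_RO RO_openin)
    moreover have "way_inside X (perp X W1) (perp X W2)" using W1 W2 by (simp add: way_inside_perp)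
    ultimately have "perp X W2 \<in> RO_at X x" using x by blast
    then have "z \<in> perp X W2" using z openin_perp by (auto simp: RO_at_def intro: spec_le_openin)
    then show False using W2 RO_openin perp_disjoint by blast
  qed
  have "spec_le X x y \<longleftrightarrow> (\<forall>V\<in>K. y \<notin> down X V)" if y: "y \<in> topspace X" for y
  proof
    assume "spec_le X x y"
    then show "\<forall>V\<in>K. y \<notin> down X V" using notin mem_down_below by metis
  next
    assume out: "\<forall>V\<in>K. y \<notin> down X V"
    have "y \<in> U" if U: "openin X U" "x \<in> U" for U
    proof -
      obtain W where W: "W \<in> RO X" "x \<in> W" "W \<subseteq> U" by (rule RO_base [OF U(1,2)])
      then have "W \<in> F" using x by (auto simp: RO_at_def)
      then show ?thesis using out y W by (auto simp: F_def)
    qed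
    then show "spec_le X x y" using x y by (simp add: spec_le_def)
  qed
  then show ?thesis by (rule that [OF x(1)])
qed

text \<open>Going up from \<open>y\<close> into the exterior of a neighbourhood of \<open>x\<close>
  leaves that neighbourhood, which is impossible for \<open>y\<close> above \<open>x\<close>. The
  converse separates \<open>y\<close> from \<open>x\<close> by a regular set.\<close>

lemma down_away:
  assumes x: "x \<in> topspace X" shows "down X (away X x) = {y \<in> topspace X. \<not> spec_le X x y}"
proof (intro subset_antisym subsetI)
  fix y assume "y \<in> down X (away X x)"
  then obtain U z where U: "U \<in> RO X" "x \<in> U" "z \<in> perp X U" "spec_le X y z"
    by (auto simp: mem_down away_def RO_at_def)
  then have "z \<notin> U" using perp_disjoint [OF RO_openin] by blast
  then have "\<not> spec_le X x y" using U by (meson RO_openin spec_le_openin spec_le_trans)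
  then show "y \<in> {y \<in> topspace X. \<not> spec_le X x y}" using U spec_leD by fast
next
  fix y assume "y \<in> {y \<in> topspace X. \<not> spec_le X x y}"
  then have y: "y \<in> topspace X" "\<not> spec_le X x y" by auto
  then obtain U where U: "openin X U" "x \<in> U" "y \<notin> U" using x by (auto simp: spec_le_def)
  obtain V where V: "V \<in> RO X" "x \<in> V" "V \<subseteq> U" by (rule RO_base [OF U(1,2)])
  \<comment> \<open>\<open>V\<close> separates \<open>x\<close> from \<open>y\<close>, but the
    exterior of \<open>V\<close> itself may have \<open>y\<close> only in its closure; the exterior
    of the smaller \<open>W\<close> has \<open>y\<close> in its down-set.\<close>
  then obtain W where W: "W \<in> RO X" "x \<in> W" "way_inside X W V" using RO_shrink by metis
  have "y \<in> X closure_of (perp X V)" using y U V by (auto simp: closure_of_perp)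
  then have "y \<in> down X (perp X W)" using way_inside_perp V W by (auto simp: way_inside_def)
  moreover have "perp X W \<subseteq> away X x" using W by (auto simp: away_def RO_at_def)
  ultimately show "y \<in> down X (away X x)" using down_mono by blast
qed

section \<open>Order-regularizations of open sets\<close>

text \<open>Every point above \<open>y\<close> lies in \<open>down X V\<close>, and all remaining
  points lie in the down-sets of exteriors of neighbourhoods of \<open>y\<close>.
  \<open>directed_point\<close> shows that one neighbourhood suffices for this cover, and it lies in
  the hull.\<close>

lemma openin_ohull:
  assumes V: "openin X V" shows "openin X (ohull X V)"
proof -
  have "\<exists>U. openin X U \<and> y \<in> U \<and> U \<subseteq> ohull X V" if y: "y \<in> ohull X V" for y
  proof -
    have yt: "y \<in> topspace X" using y by (simp add: mem_ohull)
    let ?K = "(\<lambda>U. perp X U \<union> V) ` RO_at X y"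
    have "\<exists>U\<in>RO_at X y. down X (perp X U \<union> V) = topspace X"
    proof (rule ccontr)
      assume *: "\<not> (\<exists>U\<in>RO_at X y. down X (perp X U \<union> V) = topspace X)"
      obtain z where z: "z \<in> topspace X"
        "\<And>w. w \<in> topspace X \<Longrightarrow> spec_le X z w \<longleftrightarrow> (\<forall>U\<in>?K. w \<notin> down X U)"
      proof (rule directed_point [of ?K])
        show "?K \<noteq> {}" using yt topspace_in_RO [of X] by (auto simp: RO_at_def)
        show "openin X W" if "W \<in> ?K" for W using that V by auto
        show "down X W \<noteq> topspace X" if "W \<in> ?K" for W using that * by auto
      next
        fix W W' assume "W \<in> ?K" "W' \<in> ?K"
        then obtain U U' where U: "U \<in> RO_at X y" "U' \<in> RO_at X y"
          "W = perp X U \<union> V" "W' = perp X U' \<union> V" by auto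
        then have "U \<inter> U' \<in> RO_at X y" by (auto simp: RO_at_def RO_Int)
        moreover have "W \<union> W' \<subseteq> perp X (U \<inter> U') \<union> V"
          using U perp_antimono [of "U \<inter> U'" U X] perp_antimono [of "U \<inter> U'" U' X] by auto
        ultimately show "\<exists>V''\<in>?K. W \<union> W' \<subseteq> V''" by blast
      qed (rule that)
      have out: "z \<notin> down X (perp X U)" "z \<notin> down X V" if "U \<in> RO_at X y" for U
        using z(2) [OF z(1)] spec_le_refl [OF z(1)] that by (auto simp: down_Un)
      \<comment> \<open>Avoiding the exteriors of all neighbourhoods of \<open>y\<close> places
        \<open>z\<close> above \<open>y\<close>, which contradicts avoiding
        \<open>V\<close>.\<close>
      then have "z \<notin> down X (away X y)" by (auto simp: away_def down_Union)
      then have "spec_le X y z" using z yt by (simp add: down_away)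
      then have "z \<in> down X V" using y by (simp add: mem_ohull)
      moreover have "topspace X \<in> RO_at X y" using yt by (simp add: RO_at_def topspace_in_RO)
      ultimately show False using out by blast
    qed
    then obtain U where U: "U \<in> RO X" "y \<in> U" "down X (perp X U \<union> V) = topspace X"
      by (auto simp: RO_at_def)
    \<comment> \<open>Points above \<open>U\<close> remain in \<open>U\<close> and so never reach
      its exterior; in the cover only \<open>down X V\<close> is left for them.\<close>
    have "U \<subseteq> ohull X V"
    proof
      fix u assume u: "u \<in> U"
      have "w \<in> down X V" if w: "spec_le X u w" for w
      proof -
        have "w \<in> U" using u w U RO_openin spec_le_openin by metis
        then have "v \<notin> perp X U" if "spec_le X w v" for v
          using that U RO_openin spec_le_openin perp_disjoint by (metis disjoint_iff)
        then have "w \<notin> down X (perp X U)" by (auto simp: mem_down)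
        then show ?thesis using U spec_leD [OF w] by (auto simp: down_Un)
      qed
      then show "u \<in> ohull X V" using u U(1) RO_subset [of U X] by (auto simp: mem_ohull)
    qed
    then show ?thesis using U RO_openin [of U X] by metis
  qed
  then show ?thesis using openin_subopen by metis
qed

text \<open>Unless \<open>down X V\<close> is everything, its complement is a principal up-set, and
  the separation of \<open>C\<close> from it becomes a separation from its least point
  \<open>x\<close>, as for boxes in \<open>Xi L\<close>.\<close>

lemma well_rounded_open:
  assumes V: "openin X V" shows "well_rounded X (ohull X V)"
  unfolding well_rounded_def
proof (intro conjI allI impI openin_ohull V)
  fix C assume C: "closedin X C \<and> C \<subseteq> down X (ohull X V)"
  show "\<exists>W1 W2. openin X W1 \<and> openin X W2 \<and> W1 \<inter> W2 = {} \<and>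
    C \<subseteq> down X W1 \<and> topspace X - W2 \<subseteq> down X (ohull X V)"
  proof (cases "down X V = topspace X")
    case True
    then show ?thesis
      using C V by (intro exI [of _ V] exI [of _ "{}"]) (simp add: down_ohull)
  next
    case False
    obtain x where x: "x \<in> topspace X"
      "\<And>y. y \<in> topspace X \<Longrightarrow> spec_le X x y \<longleftrightarrow> (\<forall>U\<in>{V}. y \<notin> down X U)"
      by (rule directed_point [of "{V}"]) (use False V in auto)
    have dn: "down X (ohull X V) = {y \<in> topspace X. \<not> spec_le X x y}"
      using x(2) down_subset [of X V] V by (auto simp: down_ohull)
    then have "x \<in> topspace X - C" using C x(1) spec_le_refl [OF x(1)] by auto
    moreover have "openin X (topspace X - C)" using C by blast
    ultimately have xC: "openin X (topspace X - C)" "x \<in> topspace X - C" by auto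
    obtain U where U: "U \<in> RO X" "x \<in> U" "U \<subseteq> topspace X - C"
      by (rule RO_base [OF xC])
    obtain W where W: "W \<in> RO X" "x \<in> W" "way_inside X W U" by (rule RO_shrink [OF U(1,2)])
    \<comment> \<open>The first shrinking places \<open>C\<close> under \<open>perp X W\<close>; the
      second places the complement of \<open>W\<close> under \<open>perp X W'\<close>, which is part
      of \<open>away X x\<close>.\<close>
    obtain W' where W': "W' \<in> RO X" "x \<in> W'" "way_inside X W' W" by (rule RO_shrink [OF W(1,2)])
    have "C \<subseteq> X closure_of (perp X U)"
      using U C closedin_subset by (fastforce simp: closure_of_perp)
    then have "C \<subseteq> down X (perp X W)"
      using way_inside_perp U W unfolding way_inside_def by blast
    moreover have "topspace X - W \<subseteq> down X (ohull X V)"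
    proof -
      have "topspace X - W \<subseteq> down X (perp X W')"
        using way_inside_perp [of W' W] W W' by (auto simp: way_inside_def closure_of_perp)
      moreover have "perp X W' \<subseteq> away X x" using W' by (auto simp: away_def RO_at_def)
      ultimately show ?thesis
        using dn down_away [OF x(1)] down_mono [of "perp X W'" "away X x" X] by simp
    qed
    moreover have "perp X W \<inter> W = {}" using W RO_openin perp_disjoint by blast
    ultimately show ?thesis
      using W RO_openin by (intro exI [of _ "perp X W"] exI [of _ W]) auto
  qed
qed

section \<open>The lattice operations of \<open>wORO X\<close>\<close>

text \<open>For the converse, write \<open>U\<close> as its own hull and take well-roundedness from
  \<open>well_rounded_open\<close>.\<close>

lemma carrier_wORO: "U \<in> carrier (wORO X) \<longleftrightarrow> openin X U \<and> ohull X U = U"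
  using well_rounded_open [of U] openin_subset [of X U]
  by (auto simp: wORO_def order_RO_iff_ohull)

lemma ohull_in_carrier: "openin X V \<Longrightarrow> ohull X V \<in> carrier (wORO X)"
  by (simp add: carrier_wORO openin_ohull ohull_ohull)

lemma RO_in_carrier: "U \<in> RO X \<Longrightarrow> U \<in> carrier (wORO X)"
  by (simp add: carrier_wORO RO_openin ohull_RO)

lemma le_wORO [simp]: "le (wORO X) = (\<subseteq>)"
  by (simp add: wORO_def)

lemma eq_wORO [simp]: "eq (wORO X) = (=)"
  by (simp add: wORO_def)

lemma partial_order_wORO: "partial_order (wORO X)"
  by unfold_locales auto

lemma carrier_openin: "U \<in> carrier (wORO X) \<Longrightarrow> openin X U"
  by (simp add: carrier_wORO)

lemma carrier_ohull: "U \<in> carrier (wORO X) \<Longrightarrow> ohull X U = U"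
  by (simp add: carrier_wORO)

lemma openin_Union_carrier: "K \<subseteq> carrier (wORO X) \<Longrightarrow> openin X (\<Union>K)"
  using carrier_openin by (auto intro: openin_Union)

lemma least_Upper_wORO:
  assumes K: "K \<subseteq> carrier (wORO X)"
  shows "least (wORO X) (ohull X (\<Union>K)) (Upper (wORO X) K)"
proof -
  interpret partial_order "wORO X" by (rule partial_order_wORO)
  show ?thesis
  proof (rule least_UpperI)
    fix U assume "U \<in> K"
    then show "U \<sqsubseteq>\<^bsub>wORO X\<^esub> ohull X (\<Union>K)"
      using subset_ohull [OF openin_Union_carrier [OF K]] by auto
  next
    fix V assume "V \<in> Upper (wORO X) K"
    then have V: "V \<in> carrier (wORO X)" "\<Union>K \<subseteq> V"
      using K by (auto simp: Upper_def)
    then have "ohull X (\<Union>K) \<subseteq> ohull X V" by (simp add: ohull_mono)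
    then show "ohull X (\<Union>K) \<sqsubseteq>\<^bsub>wORO X\<^esub> V" using V by (simp add: carrier_ohull)
  qed (simp_all add: K ohull_in_carrier openin_Union_carrier)
qed

lemma complete_lattice_wORO: "complete_lattice (wORO X)"
proof -
  interpret partial_order "wORO X" by (rule partial_order_wORO)
  show ?thesis
  proof (rule complete_latticeI)
    fix K assume K: "K \<subseteq> carrier (wORO X)"
    show "\<exists>s. least (wORO X) s (Upper (wORO X) K)" using least_Upper_wORO [OF K] by blast
    let ?D = "Lower (wORO X) K"
    have D: "?D \<subseteq> carrier (wORO X)" by simp
    have "greatest (wORO X) (ohull X (\<Union>?D)) ?D"
    proof (rule greatest_LowerI)
      fix U assume U: "U \<in> K"
      then have "\<Union>?D \<subseteq> U" using K by (auto simp: Lower_def)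
      then have "ohull X (\<Union>?D) \<subseteq> ohull X U" by (rule ohull_mono)
      then show "ohull X (\<Union>?D) \<sqsubseteq>\<^bsub>wORO X\<^esub> U" using U K carrier_ohull [of U] by auto
    next
      fix V assume "V \<in> ?D"
      then show "V \<sqsubseteq>\<^bsub>wORO X\<^esub> ohull X (\<Union>?D)"
        using subset_ohull [OF openin_Union_carrier [OF D]] by auto
    qed (simp_all add: K ohull_in_carrier openin_Union_carrier)
    then show "\<exists>i. greatest (wORO X) i (Lower (wORO X) K)" by blast
  qed
qed

lemma Sup_wORO:
  assumes "K \<subseteq> carrier (wORO X)" shows "\<Squnion>\<^bsub>wORO X\<^esub> K = ohull X (\<Union>K)"
proof -
  interpret complete_lattice "wORO X" by (rule complete_lattice_wORO)
  show ?thesis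
    using least_unique [OF sup_lub [OF assms] least_Upper_wORO [OF assms]] .
qed

lemma join_wORO:
  "\<lbrakk>U \<in> carrier (wORO X); V \<in> carrier (wORO X)\<rbrakk> \<Longrightarrow> U \<squnion>\<^bsub>wORO X\<^esub> V = ohull X (U \<union> V)"
  by (simp add: join_def Sup_wORO)

lemma Int_in_carrier:
  assumes "U \<in> carrier (wORO X)" "V \<in> carrier (wORO X)" shows "U \<inter> V \<in> carrier (wORO X)"
  using assms Int_ohull [of X U V] by (auto simp: carrier_wORO)

lemma meet_wORO:
  assumes "U \<in> carrier (wORO X)" "V \<in> carrier (wORO X)" shows "U \<sqinter>\<^bsub>wORO X\<^esub> V = U \<inter> V"
proof -
  interpret complete_lattice "wORO X" by (rule complete_lattice_wORO)
  have "U \<inter> V \<sqsubseteq>\<^bsub>wORO X\<^esub> U \<sqinter>\<^bsub>wORO X\<^esub> V"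
    using assms by (intro meet_le) (auto simp: Int_in_carrier)
  moreover have "U \<sqinter>\<^bsub>wORO X\<^esub> V \<sqsubseteq>\<^bsub>wORO X\<^esub> U" "U \<sqinter>\<^bsub>wORO X\<^esub> V \<sqsubseteq>\<^bsub>wORO X\<^esub> V"
    using assms by (intro meet_left meet_right; simp)+
  ultimately show ?thesis by auto
qed

lemma top_wORO: "\<top>\<^bsub>wORO X\<^esub> = topspace X"
proof -
  interpret complete_lattice "wORO X" by (rule complete_lattice_wORO)
  have "topspace X \<in> carrier (wORO X)" by (simp add: RO_in_carrier topspace_in_RO)
  then show ?thesis
    using top_higher [of "topspace X"] openin_subset [OF carrier_openin [OF top_closed]] by auto
qed

lemma bottom_wORO: "\<bottom>\<^bsub>wORO X\<^esub> = {}"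
proof -
  interpret complete_lattice "wORO X" by (rule complete_lattice_wORO)
  have "{} \<in> carrier (wORO X)" using spec_le_refl by (fastforce simp: carrier_wORO mem_ohull mem_down)
  then show ?thesis using bottom_lower [of "{}"] by auto
qed

lemma neg_wORO:
  assumes "U \<in> carrier (wORO X)" shows "pseudo_complement (wORO X) U = perp X U"
proof -
  let ?K = "{V \<in> carrier (wORO X). U \<sqinter>\<^bsub>wORO X\<^esub> V = \<bottom>\<^bsub>wORO X\<^esub>}"
  have U: "openin X U" using assms by (rule carrier_openin)
  have "perp X U \<in> ?K"
    using assms U by (simp add: meet_wORO bottom_wORO perp_disjoint RO_in_carrier perp_in_RO)
  moreover have "V \<subseteq> perp X U" if "V \<in> ?K" for V
    using that assms U by (auto simp: meet_wORO bottom_wORO subset_perp_iff carrier_openin Int_commute)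
  ultimately have "\<Union>?K = perp X U" by blast
  moreover have "pseudo_complement (wORO X) U = ohull X (\<Union>?K)"
    unfolding pseudo_complement_def by (rule Sup_wORO) auto
  ultimately show ?thesis using U by (simp add: ohull_RO perp_in_RO)
qed

text \<open>Rather-below unfolds to a cover by \<open>down X V\<close> and
  \<open>down X (perp X U)\<close>, whereas \<open>way_inside\<close> asks for a cover by
  \<open>down X V\<close> and \<open>perp X U\<close>. Order-regularity of \<open>perp X U\<close>
  closes the gap.\<close>

lemma rather_below_wORO:
  assumes U: "U \<in> carrier (wORO X)" and V: "V \<in> carrier (wORO X)"
  shows "rather_below (wORO X) U V \<longleftrightarrow> way_inside X U V"
proof -
  have opU: "openin X U" using U by (rule carrier_openin)
  have "rather_below (wORO X) U V \<longleftrightarrow> down X V \<union> down X (perp X U) = topspace X"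
    using U V opU
    by (simp add: rather_below_def neg_wORO join_wORO RO_in_carrier perp_in_RO top_wORO
        ohull_eq_topspace down_Un)
  also have "\<dots> \<longleftrightarrow> X closure_of U \<subseteq> down X V"
  proof
    assume *: "down X V \<union> down X (perp X U) = topspace X"
    show "X closure_of U \<subseteq> down X V"
    proof
      fix x assume x: "x \<in> X closure_of U"
      then have xt: "x \<in> topspace X" using closure_of_subset_topspace by (rule subsetD [rotated])
      show "x \<in> down X V"
      proof (rule ccontr)
        assume "x \<notin> down X V"
        \<comment> \<open>Nothing above \<open>x\<close> can be in \<open>down X V\<close>, so
          everything above \<open>x\<close> is covered by the other half.\<close>
        then have "x \<in> ohull X (perp X U)"
          using * xt spec_leD mem_down_below by (fastforce simp: mem_ohull)
        then show False
          using x opU by (simp add: ohull_RO perp_in_RO) (simp add: perp_def)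
      qed
    qed
  next
    assume *: "X closure_of U \<subseteq> down X V"
    have "topspace X - X closure_of U \<subseteq> down X (perp X U)"
      using subset_down [OF perp_subset, of X U] by (simp add: perp_def)
    then show "down X V \<union> down X (perp X U) = topspace X"
      using * down_subset [of X V] down_subset [of X "perp X U"] by blast
  qed
  finally show ?thesis by (simp add: way_inside_def)
qed

text \<open>The frame law is \<open>Int_ohull\<close>, compactness comes from
  \<open>directed_point\<close>, and regularity from the base of regular sets together with
  concordance.\<close>

theorem compact_regular_frame_wORO: "compact_regular_frame (wORO X)"
proof -
  interpret complete_lattice "wORO X" by (rule complete_lattice_wORO)
  show ?thesis
  proof unfold_locales
    fix U K assume UK: "U \<in> carrier (wORO X)" "K \<subseteq> carrier (wORO X)"
    have 1: "(\<lambda>V. U \<sqinter>\<^bsub>wORO X\<^esub> V) ` K = (\<lambda>V. U \<inter> V) ` K"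
      using UK by (intro image_cong) (auto simp: meet_wORO)
    have 2: "(\<lambda>V. U \<inter> V) ` K \<subseteq> carrier (wORO X)" using UK by (auto simp: Int_in_carrier)
    have "U \<sqinter>\<^bsub>wORO X\<^esub> (\<Squnion>\<^bsub>wORO X\<^esub> K) = U \<inter> ohull X (\<Union>K)"
      using UK by (simp add: meet_wORO Sup_wORO ohull_in_carrier openin_Union_carrier)
    also have "\<dots> = ohull X (U \<inter> \<Union>K)"
      using UK by (simp add: Int_ohull carrier_openin carrier_ohull openin_Union_carrier)
    also have "U \<inter> \<Union>K = \<Union>((\<lambda>V. U \<inter> V) ` K)" by blast
    also have "ohull X (\<Union>((\<lambda>V. U \<inter> V) ` K)) = \<Squnion>\<^bsub>wORO X\<^esub> ((\<lambda>V. U \<sqinter>\<^bsub>wORO X\<^esub> V) ` K)"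
      unfolding 1 using 2 by (simp add: Sup_wORO)
    finally show "U \<sqinter>\<^bsub>wORO X\<^esub> (\<Squnion>\<^bsub>wORO X\<^esub> K) = \<Squnion>\<^bsub>wORO X\<^esub> ((\<lambda>V. U \<sqinter>\<^bsub>wORO X\<^esub> V) ` K)" .
  next
    fix K assume K: "K \<subseteq> carrier (wORO X)" "\<Squnion>\<^bsub>wORO X\<^esub> K = \<top>\<^bsub>wORO X\<^esub>"
    show "\<exists>K'\<subseteq>K. finite K' \<and> \<Squnion>\<^bsub>wORO X\<^esub> K' = \<top>\<^bsub>wORO X\<^esub>"
    proof (rule ccontr)
      assume no: "\<not> (\<exists>K'\<subseteq>K. finite K' \<and> \<Squnion>\<^bsub>wORO X\<^esub> K' = \<top>\<^bsub>wORO X\<^esub>)"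
      \<comment> \<open>Finite unions make the family directed, and the absence of a finite subcover
        is the properness that \<open>directed_point\<close> requires. The point found avoids every
        \<open>down X U\<close>, although these cover the space.\<close>
      let ?F = "{\<Union>K' | K'. K' \<subseteq> K \<and> finite K'}"
      obtain x where x: "x \<in> topspace X"
        "\<And>y. y \<in> topspace X \<Longrightarrow> spec_le X x y \<longleftrightarrow> (\<forall>V\<in>?F. y \<notin> down X V)"
      proof (rule directed_point [of ?F])
        show "?F \<noteq> {}" by blast
        show "openin X V" if "V \<in> ?F" for V
          using that K openin_Union_carrier by auto
        show "down X V \<noteq> topspace X" if "V \<in> ?F" for V
        proof -
          obtain K' where K': "K' \<subseteq> K" "finite K'" "V = \<Union>K'" using \<open>V \<in> ?F\<close> by blast
          then have "ohull X V \<noteq> topspace X" using no K Sup_wORO [of K'] by (auto simp: top_wORO)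
          then show ?thesis by (simp add: ohull_eq_topspace)
        qed
      next
        fix V V' assume "V \<in> ?F" "V' \<in> ?F"
        then obtain K' K'' where "K' \<subseteq> K" "finite K'" "V = \<Union>K'" "K'' \<subseteq> K" "finite K''" "V' = \<Union>K''"
          by blast
        then have "K' \<union> K'' \<subseteq> K" "finite (K' \<union> K'')" "V \<union> V' \<subseteq> \<Union>(K' \<union> K'')" by auto
        then show "\<exists>V''\<in>?F. V \<union> V' \<subseteq> V''"
          by (intro bexI [of _ "\<Union>(K' \<union> K'')"] CollectI exI [of _ "K' \<union> K''"] conjI HOL.refl)
      qed (rule that)
      have "down X (\<Union>K) = topspace X"
        using K by (simp add: Sup_wORO top_wORO ohull_eq_topspace)
      then obtain U where U: "U \<in> K" "x \<in> down X U" using x(1) by (auto simp: down_Union)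
      then have "\<Union>{U} \<in> ?F" by blast
      moreover have "\<forall>V\<in>?F. x \<notin> down X V" using x(2) [OF x(1)] spec_le_refl [OF x(1)] by (rule iffD1)
      ultimately have "x \<notin> down X (\<Union>{U})" by (rule bspec [rotated])
      then show False using U(2) by simp
    qed
  next
    fix U assume U: "U \<in> carrier (wORO X)"
    let ?K = "{V \<in> carrier (wORO X). rather_below (wORO X) V U}"
    have "V \<subseteq> U" if "V \<in> ?K" for V
    proof -
      have V: "V \<in> carrier (wORO X)" "way_inside X V U" using that U by (auto simp: rather_below_wORO)
      have "V \<subseteq> X closure_of V"
        using V carrier_openin openin_subset by (intro closure_of_subset) blast
      then have "Int_le X (down X V) \<subseteq> Int_le X (down X (down X U))"
        using V by (intro Int_le_mono down_mono) (auto simp: way_inside_def)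
      then show ?thesis using U V carrier_ohull by (simp add: down_down flip: ohull_def)
    qed
    \<comment> \<open>The plain union already exhausts \<open>U\<close>, so the hull in the formula
      for joins adds nothing.\<close>
    moreover have "U \<subseteq> \<Union>?K"
    proof
      fix x assume x: "x \<in> U"
      obtain V where V: "V \<in> RO X" "x \<in> V" "V \<subseteq> U" by (rule RO_base [OF carrier_openin [OF U] x])
      obtain W where W: "W \<in> RO X" "x \<in> W" "way_inside X W V" by (rule RO_shrink [OF V(1,2)])
      have "way_inside X W U" using W(3) down_mono [OF V(3)] unfolding way_inside_def by blast
      then have "W \<in> ?K" using W(1) U by (simp add: rather_below_wORO RO_in_carrier)
      then show "x \<in> \<Union>?K" using W(2) by blast
    qed
    ultimately have "\<Union>?K = U" by blast
    moreover have "\<Squnion>\<^bsub>wORO X\<^esub> ?K = ohull X (\<Union>?K)" by (rule Sup_wORO) auto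
    ultimately show "U = \<Squnion>\<^bsub>wORO X\<^esub> ?K" using U by (simp add: carrier_ohull)
  qed
qed

section \<open>Points of \<open>X\<close> as elements of \<open>wORO X\<close>\<close>

lemma eps_in_carrier: "eps X x \<in> carrier (wORO X)"
  by (simp add: eps_def ohull_in_carrier openin_away)

lemma down_eps:
  "x \<in> topspace X \<Longrightarrow> down X (eps X x) = {y \<in> topspace X. \<not> spec_le X x y}"
  by (simp add: eps_def down_ohull openin_away down_away)

lemma mem_eps:
  "x \<in> topspace X \<Longrightarrow> y \<in> eps X x \<longleftrightarrow> y \<in> topspace X \<and> (\<forall>z. spec_le X y z \<longrightarrow> \<not> spec_le X x z)"
  using spec_leD [of X y] by (auto simp: eps_def mem_ohull down_away)

lemma eps_subset_iff:
  assumes "x \<in> topspace X" "y \<in> topspace X" shows "eps X x \<subseteq> eps X y \<longleftrightarrow> spec_le X x y"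
proof
  assume "eps X x \<subseteq> eps X y"
  then have "down X (eps X x) \<subseteq> down X (eps X y)" by (rule down_mono)
  then show "spec_le X x y" using assms spec_le_refl [of y X] by (auto simp: down_eps)
next
  assume "spec_le X x y"
  then show "eps X x \<subseteq> eps X y" using assms spec_le_trans [of X x y] unfolding subset_iff by (metis mem_eps)
qed

lemma spec_le_antisym: "\<lbrakk>spec_le X x y; spec_le X y x\<rbrakk> \<Longrightarrow> x = y"
proof -
  assume *: "spec_le X x y" "spec_le X y x"
  have "t0_space X" using dV by (simp add: dV_space_def)
  then show "x = y" using * unfolding t0_space_def spec_le_def by metis
qed

lemma inj_on_eps: "inj_on (eps X) (topspace X)"
  by (rule inj_onI) (metis eps_subset_iff spec_le_antisym order_refl)

text \<open>For surjectivity, apply \<open>directed_point\<close> to the one-element family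
  \<open>{U}\<close>: the complement of \<open>down X U\<close> is the up-set of some
  \<open>x\<close>. An element of \<open>wORO X\<close> is determined by its down-set, so it equals
  \<open>eps X x\<close>.\<close>

lemma eps_image: "eps X ` topspace X = Xi_points (wORO X)"
proof (intro subset_antisym subsetI)
  fix U assume "U \<in> eps X ` topspace X"
  then obtain x where x: "x \<in> topspace X" "U = eps X x" by auto
  then have "x \<notin> U" using spec_le_refl [of x X] by (auto simp: mem_eps)
  then show "U \<in> Xi_points (wORO X)"
    using x eps_in_carrier by (auto simp: Xi_points_def top_wORO)
next
  fix U assume "U \<in> Xi_points (wORO X)"
  then have U: "U \<in> carrier (wORO X)" "U \<noteq> topspace X" by (auto simp: Xi_points_def top_wORO)
  obtain x where x: "x \<in> topspace X"
    "\<And>y. y \<in> topspace X \<Longrightarrow> spec_le X x y \<longleftrightarrow> (\<forall>V\<in>{U}. y \<notin> down X V)"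
  proof (rule directed_point [of "{U}"])
    show "down X V \<noteq> topspace X" if "V \<in> {U}" for V
      using that U by (simp add: carrier_ohull flip: ohull_eq_topspace)
    show "openin X V" if "V \<in> {U}" for V using that U carrier_openin by simp
  qed (use that in auto)
  then have "down X (eps X x) = down X U" using down_subset [of X U] by (auto simp: down_eps)
  then have "ohull X (eps X x) = ohull X U" by (simp add: ohull_def)
  then have "U = eps X x" using U by (simp add: carrier_ohull eps_in_carrier)
  then show "U \<in> eps X ` topspace X" using x by blast
qed

text \<open>The down-set of \<open>eps X x\<close> misses just the points above \<open>x\<close>.
  Hence its join with \<open>U\<close> is the top iff every point above \<open>x\<close> is in
  \<open>down X U\<close>, and this says that \<open>x\<close> lies in the hull of
  \<open>U\<close>.\<close>

lemma Box_wORO: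
  assumes U: "U \<in> carrier (wORO X)" shows "Box (wORO X) U = eps X ` U"
proof -
  have "eps X x \<squnion>\<^bsub>wORO X\<^esub> U = \<top>\<^bsub>wORO X\<^esub> \<longleftrightarrow> x \<in> U" if x: "x \<in> topspace X" for x
  proof -
    have "eps X x \<squnion>\<^bsub>wORO X\<^esub> U = \<top>\<^bsub>wORO X\<^esub> \<longleftrightarrow> down X (eps X x) \<union> down X U = topspace X"
      using U by (simp add: join_wORO eps_in_carrier top_wORO ohull_eq_topspace down_Un)
    also have "\<dots> \<longleftrightarrow> x \<in> ohull X U"
      using x down_subset [of X U] spec_leD [of X x] by (auto simp: down_eps mem_ohull)
    finally show ?thesis using U by (simp add: carrier_ohull)
  qed
  then have "Box (wORO X) U = eps X ` {x \<in> topspace X. x \<in> U}"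
    unfolding Box_def eps_image [symmetric] by blast
  also have "{x \<in> topspace X. x \<in> U} = U"
    using openin_subset [OF carrier_openin [OF U]] by blast
  finally show ?thesis .
qed

lemma krframe_wORO: "krframe (wORO X)"
  by (simp add: krframe_def compact_regular_frame_wORO)

interpretation wORO: krframe "wORO X"
  by (rule krframe_wORO)

text \<open>By \<open>Box_wORO\<close> the boxes are the images of the elements of
  \<open>wORO X\<close>, and these form a base of \<open>X\<close> because they include the regular
  open sets.\<close>

theorem homeomorphic_map_eps: "homeomorphic_map X (Xi (wORO X)) (eps X)"
proof -
  have "openin (Xi (wORO X)) (eps X ` S) \<longleftrightarrow> openin X S" if S: "S \<subseteq> topspace X" for S
  proof -
    have sub: "eps X ` S \<subseteq> Xi_points (wORO X)" using S eps_image by blast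
    have mem: "eps X x \<in> eps X ` A \<longleftrightarrow> x \<in> A" if "A \<subseteq> topspace X" "x \<in> topspace X" for A x
      using inj_on_image_mem_iff [OF inj_on_eps] that by metis
    have sub_top: "U \<subseteq> topspace X" if "U \<in> carrier (wORO X)" for U
      using that carrier_openin openin_subset by metis
    have img: "eps X ` U \<subseteq> eps X ` S \<longleftrightarrow> U \<subseteq> S" if "U \<in> carrier (wORO X)" for U
      using mem [OF S] sub_top [OF that] by blast
    have mem: "eps X x \<in> eps X ` U \<longleftrightarrow> x \<in> U" if "U \<in> carrier (wORO X)" "x \<in> S" for U x
      using mem [OF sub_top [OF that(1)]] that(2) S by (meson subsetD)
    have "openin (Xi (wORO X)) (eps X ` S) \<longleftrightarrow> (\<forall>x\<in>S. \<exists>U\<in>carrier (wORO X). x \<in> U \<and> U \<subseteq> S)"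
      using sub by (simp add: wORO.openin_Xi Box_wORO img mem cong: bex_cong)
    also have "\<dots> \<longleftrightarrow> openin X S"
    proof
      assume "\<forall>x\<in>S. \<exists>U\<in>carrier (wORO X). x \<in> U \<and> U \<subseteq> S"
      then show "openin X S" using carrier_openin openin_subopen by metis
    next
      assume "openin X S"
      then show "\<forall>x\<in>S. \<exists>U\<in>carrier (wORO X). x \<in> U \<and> U \<subseteq> S"
        using RO_base RO_in_carrier by metis
    qed
    finally show ?thesis .
  qed
  note op = this
  \<comment> \<open>Quotient maps are phrased with preimages; bijectivity of \<open>eps X\<close>
    converts the statement about images.\<close>
  have pre: "openin X {x \<in> topspace X. eps X x \<in> U} \<longleftrightarrow> openin (Xi (wORO X)) U"
    if "U \<subseteq> Xi_points (wORO X)" for U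
  proof -
    let ?S = "{x \<in> topspace X. eps X x \<in> U}"
    have "openin (Xi (wORO X)) (eps X ` ?S) \<longleftrightarrow> openin X ?S" by (rule op) blast
    moreover have "eps X ` ?S = U"
    proof (intro subset_antisym subsetI)
      fix W assume W: "W \<in> U"
      then have "W \<in> eps X ` topspace X" using subsetD [OF that W] eps_image by simp
      then obtain x where "x \<in> topspace X" "W = eps X x" by (elim imageE)
      then show "W \<in> eps X ` ?S" using W by (intro image_eqI [of _ _ x]) simp_all
    qed (elim imageE CollectE conjE; simp)
    ultimately show ?thesis by (simp only:)
  qed
  show ?thesis
    unfolding homeomorphic_map_def quotient_map_def wORO.topspace_Xi
  proof (intro conjI allI impI)
    show "eps X ` topspace X = Xi_points (wORO X)" by (rule eps_image)
    show "inj_on (eps X) (topspace X)" by (rule inj_on_eps)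
    fix U assume "U \<subseteq> Xi_points (wORO X)"
    then show "openin X {x \<in> topspace X. eps X x \<in> U} = openin (Xi (wORO X)) U" by (rule pre)
  qed
qed

end

section \<open>Morphisms\<close>

lemma (in krframe) eq_of_le_iff:
  assumes "x \<in> carrier L" "y \<in> carrier L" "\<And>a. a \<in> carrier L \<Longrightarrow> a \<sqsubseteq> x \<longleftrightarrow> a \<sqsubseteq> y"
  shows "x = y"
  using assms by (meson le_antisym le_refl)

text \<open>An order isomorphism is both left and right adjoint to its inverse, hence preserves all
  joins and meets.\<close>

lemma order_iso_in_frame_hom:
  assumes "krframe L" "krframe M"
    and f: "f \<in> carrier L \<rightarrow>\<^sub>E carrier M" and g: "g \<in> carrier M \<rightarrow> carrier L"
    and gf: "\<And>a. a \<in> carrier L \<Longrightarrow> g (f a) = a" and fg: "\<And>b. b \<in> carrier M \<Longrightarrow> f (g b) = b"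
    and f_mono: "\<And>a a'. \<lbrakk>a \<in> carrier L; a' \<in> carrier L; a \<sqsubseteq>\<^bsub>L\<^esub> a'\<rbrakk> \<Longrightarrow> f a \<sqsubseteq>\<^bsub>M\<^esub> f a'"
    and g_mono: "\<And>b b'. \<lbrakk>b \<in> carrier M; b' \<in> carrier M; b \<sqsubseteq>\<^bsub>M\<^esub> b'\<rbrakk> \<Longrightarrow> g b \<sqsubseteq>\<^bsub>L\<^esub> g b'"
  shows "f \<in> frame_hom L M"
proof -
  interpret L: krframe L by fact
  interpret M: krframe M by fact
  have fc: "f a \<in> carrier M" if "a \<in> carrier L" for a using that f by auto
  have gc: "g b \<in> carrier L" if "b \<in> carrier M" for b using that g by auto
  have le_iff: "f a \<sqsubseteq>\<^bsub>M\<^esub> b \<longleftrightarrow> a \<sqsubseteq>\<^bsub>L\<^esub> g b" "b \<sqsubseteq>\<^bsub>M\<^esub> f a \<longleftrightarrow> g b \<sqsubseteq>\<^bsub>L\<^esub> a"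
    if "a \<in> carrier L" "b \<in> carrier M" for a b
    using that f_mono g_mono gf fg fc gc by metis+
  have "f \<top>\<^bsub>L\<^esub> = \<top>\<^bsub>M\<^esub>"
  proof -
    have "\<top>\<^bsub>M\<^esub> \<sqsubseteq>\<^bsub>M\<^esub> f \<top>\<^bsub>L\<^esub>" by (simp add: le_iff gc)
    then show ?thesis by (simp add: fc)
  qed
  moreover have "f (a \<sqinter>\<^bsub>L\<^esub> b) = f a \<sqinter>\<^bsub>M\<^esub> f b" if "a \<in> carrier L" "b \<in> carrier L" for a b
    using that by (intro M.eq_of_le_iff) (simp_all add: fc gc M.meet_iff L.meet_iff le_iff(2))
  moreover have "f (\<Squnion>\<^bsub>L\<^esub> B) = \<Squnion>\<^bsub>M\<^esub> (f ` B)" if B: "B \<subseteq> carrier L" for B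
  proof (rule M.le_antisym)
    have fB: "f ` B \<subseteq> carrier M" using B fc by auto
    show "f (\<Squnion>\<^bsub>L\<^esub> B) \<in> carrier M" "\<Squnion>\<^bsub>M\<^esub> (f ` B) \<in> carrier M" using B fB by (simp_all add: fc)
    have "a \<sqsubseteq>\<^bsub>L\<^esub> g (\<Squnion>\<^bsub>M\<^esub> (f ` B))" if "a \<in> B" for a
    proof -
      have "f a \<sqsubseteq>\<^bsub>M\<^esub> \<Squnion>\<^bsub>M\<^esub> (f ` B)" using that fB by (intro M.sup_upper) auto
      then show ?thesis using that B fB by (subst (asm) le_iff) auto
    qed
    then have "\<Squnion>\<^bsub>L\<^esub> B \<sqsubseteq>\<^bsub>L\<^esub> g (\<Squnion>\<^bsub>M\<^esub> (f ` B))" using B fB by (intro L.sup_least) (auto simp: gc)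
    then show "f (\<Squnion>\<^bsub>L\<^esub> B) \<sqsubseteq>\<^bsub>M\<^esub> \<Squnion>\<^bsub>M\<^esub> (f ` B)" using B fB by (subst le_iff) auto
    show "\<Squnion>\<^bsub>M\<^esub> (f ` B) \<sqsubseteq>\<^bsub>M\<^esub> f (\<Squnion>\<^bsub>L\<^esub> B)"
      using B fB by (intro M.sup_least) (auto intro!: f_mono L.sup_upper fc)
  qed
  ultimately show ?thesis using f by (simp add: frame_hom_def)
qed

lemma order_iso_in_frame_iso:
  assumes "krframe L" "krframe M"
    and f: "f \<in> carrier L \<rightarrow>\<^sub>E carrier M" and g: "g \<in> carrier M \<rightarrow> carrier L"
    and gf: "\<And>a. a \<in> carrier L \<Longrightarrow> g (f a) = a" and fg: "\<And>b. b \<in> carrier M \<Longrightarrow> f (g b) = b"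
    and f_mono: "\<And>a a'. \<lbrakk>a \<in> carrier L; a' \<in> carrier L; a \<sqsubseteq>\<^bsub>L\<^esub> a'\<rbrakk> \<Longrightarrow> f a \<sqsubseteq>\<^bsub>M\<^esub> f a'"
    and g_mono: "\<And>b b'. \<lbrakk>b \<in> carrier M; b' \<in> carrier M; b \<sqsubseteq>\<^bsub>M\<^esub> b'\<rbrakk> \<Longrightarrow> g b \<sqsubseteq>\<^bsub>L\<^esub> g b'"
  shows "f \<in> frame_iso L M"
proof -
  have "f \<in> frame_hom L M" by (rule order_iso_in_frame_hom [OF assms])
  moreover have "restrict g (carrier M) \<in> frame_hom M L"
    by (rule order_iso_in_frame_hom [OF assms(2,1), where g = f]) (use assms in auto)
  moreover have "\<forall>a\<in>carrier L. restrict g (carrier M) (f a) = a"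
    "\<forall>b\<in>carrier M. f (restrict g (carrier M) b) = b"
    using f g gf fg by auto
  ultimately show ?thesis unfolding frame_iso_def by blast
qed

context krframe
begin

interpretation Xi: dV "Xi L"
  by (simp add: dV_def dV_space_Xi)

lemma ohull_Xi: "openin (Xi L) U \<Longrightarrow> ohull (Xi L) U = Box L (core U)"
  by (simp add: ohull_def Int_le_down_open)

lemma Box_in_carrier: "a \<in> carrier L \<Longrightarrow> Box L a \<in> carrier (wORO (Xi L))"
  by (simp add: Xi.carrier_wORO openin_box ohull_Xi core_box)

lemma Box_core: "U \<in> carrier (wORO (Xi L)) \<Longrightarrow> Box L (core U) = U"
  by (metis Xi.carrier_wORO ohull_Xi)

lemma Box_in_frame_iso: "restrict (Box L) (carrier L) \<in> frame_iso L (wORO (Xi L))"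
proof (rule order_iso_in_frame_iso [where g = core])
  show "krframe L" by unfold_locales
  show "krframe (wORO (Xi L))" by (rule Xi.krframe_wORO)
  fix U V assume UV: "U \<in> carrier (wORO (Xi L))" "V \<in> carrier (wORO (Xi L))" "U \<sqsubseteq>\<^bsub>wORO (Xi L)\<^esub> V"
  then have "Box L (core U) \<subseteq> Box L (core V)" by (simp add: Box_core)
  then show "core U \<sqsubseteq> core V" by (simp add: box_subset_iff)
qed (auto simp: Box_in_carrier core_box Box_core box_subset_iff)

end

section \<open>The right adjoint of a frame morphism\<close>

locale kr_hom = L: krframe L + M: krframe M for L :: "'a gorder" and M :: "'b gorder" +
  fixes f
  assumes hom: "f \<in> frame_hom L M"
begin

lemma closed [simp]: "a \<in> carrier L \<Longrightarrow> f a \<in> carrier M"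
  using hom by (auto simp: frame_hom_def)

lemma map_meet: "\<lbrakk>a \<in> carrier L; b \<in> carrier L\<rbrakk> \<Longrightarrow> f (a \<sqinter>\<^bsub>L\<^esub> b) = f a \<sqinter>\<^bsub>M\<^esub> f b"
  using hom by (simp add: frame_hom_def)

lemma map_top: "f \<top>\<^bsub>L\<^esub> = \<top>\<^bsub>M\<^esub>"
  using hom by (simp add: frame_hom_def)

lemma map_Sup: "B \<subseteq> carrier L \<Longrightarrow> f (\<Squnion>\<^bsub>L\<^esub> B) = \<Squnion>\<^bsub>M\<^esub> (f ` B)"
  using hom by (simp add: frame_hom_def)

lemma map_join: "\<lbrakk>a \<in> carrier L; b \<in> carrier L\<rbrakk> \<Longrightarrow> f (a \<squnion>\<^bsub>L\<^esub> b) = f a \<squnion>\<^bsub>M\<^esub> f b"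
  by (simp add: join_def map_Sup)

lemma map_bot: "f \<bottom>\<^bsub>L\<^esub> = \<bottom>\<^bsub>M\<^esub>"
proof -
  have "\<Squnion>\<^bsub>L\<^esub> {} = \<bottom>\<^bsub>L\<^esub>" "\<Squnion>\<^bsub>M\<^esub> {} = \<bottom>\<^bsub>M\<^esub>"
    using L.weak_sup_empty M.weak_sup_empty by (simp_all add: L.eq_is_equal M.eq_is_equal)
  then show ?thesis using map_Sup [of "{}"] by simp
qed

lemma map_mono: "\<lbrakk>a \<in> carrier L; b \<in> carrier L; a \<sqsubseteq>\<^bsub>L\<^esub> b\<rbrakk> \<Longrightarrow> f a \<sqsubseteq>\<^bsub>M\<^esub> f b"
  by (metis L.le_iff_join M.meet_right closed map_meet)

definition radj :: "'b \<Rightarrow> 'a" where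
  "radj b = \<Squnion>\<^bsub>L\<^esub> {a \<in> carrier L. f a \<sqsubseteq>\<^bsub>M\<^esub> b}"

lemma radj_closed [simp]: "radj b \<in> carrier L"
  unfolding radj_def by (rule L.sup_closed) auto

lemma map_radj_le: assumes "b \<in> carrier M" shows "f (radj b) \<sqsubseteq>\<^bsub>M\<^esub> b"
proof -
  have "f (radj b) = \<Squnion>\<^bsub>M\<^esub> (f ` {a \<in> carrier L. f a \<sqsubseteq>\<^bsub>M\<^esub> b})"
    unfolding radj_def by (rule map_Sup) auto
  also have "\<dots> \<sqsubseteq>\<^bsub>M\<^esub> b" using assms by (intro M.sup_least) auto
  finally show ?thesis .
qed

lemma le_radj_iff:
  assumes "a \<in> carrier L" "b \<in> carrier M" shows "a \<sqsubseteq>\<^bsub>L\<^esub> radj b \<longleftrightarrow> f a \<sqsubseteq>\<^bsub>M\<^esub> b"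
proof
  assume "a \<sqsubseteq>\<^bsub>L\<^esub> radj b"
  then have "f a \<sqsubseteq>\<^bsub>M\<^esub> f (radj b)" using assms by (simp add: map_mono)
  then show "f a \<sqsubseteq>\<^bsub>M\<^esub> b" using assms map_radj_le M.le_trans by (meson closed radj_closed)
next
  assume "f a \<sqsubseteq>\<^bsub>M\<^esub> b"
  then show "a \<sqsubseteq>\<^bsub>L\<^esub> radj b" unfolding radj_def using assms by (intro L.sup_upper) auto
qed

lemma radj_point:
  assumes "b \<in> Xi_points M" shows "radj b \<in> Xi_points L"
proof -
  have "radj b \<noteq> \<top>\<^bsub>L\<^esub>"
    using assms map_radj_le [of b] by (auto simp: map_top M.mem_points)
  then show ?thesis by (simp add: L.mem_points)
qed

text \<open>The nontrivial direction replaces \<open>a\<close> by some \<open>c\<close> rather below it with \<open>f c\<close> still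
  covering the complement of \<open>b\<close>; then \<open>f (\<not> c) \<le> b\<close>.\<close>

lemma radj_join_eq_top:
  assumes a: "a \<in> carrier L" and b: "b \<in> carrier M"
  shows "radj b \<squnion>\<^bsub>L\<^esub> a = \<top>\<^bsub>L\<^esub> \<longleftrightarrow> b \<squnion>\<^bsub>M\<^esub> f a = \<top>\<^bsub>M\<^esub>"
proof
  assume "radj b \<squnion>\<^bsub>L\<^esub> a = \<top>\<^bsub>L\<^esub>"
  then have "f (radj b) \<squnion>\<^bsub>M\<^esub> f a = \<top>\<^bsub>M\<^esub>" using a by (metis map_join map_top radj_closed)
  then show "b \<squnion>\<^bsub>M\<^esub> f a = \<top>\<^bsub>M\<^esub>"
    using a b map_radj_le [OF b] by - (rule M.join_eq_top_mono [of "f a" "f (radj b)"], simp_all)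
next
  assume top: "b \<squnion>\<^bsub>M\<^esub> f a = \<top>\<^bsub>M\<^esub>"
  let ?D = "{c \<in> carrier L. rather_below L c a}"
  have "f a = \<Squnion>\<^bsub>M\<^esub> (f ` ?D)" using L.regular [OF a] map_Sup [of ?D] by force
  moreover have "f ` ?D \<noteq> {}" using L.rather_below_directed(1) [OF a] by blast
  moreover have "\<exists>z\<in>f ` ?D. x \<sqsubseteq>\<^bsub>M\<^esub> z \<and> y \<sqsubseteq>\<^bsub>M\<^esub> z" if xy: "x \<in> f ` ?D" "y \<in> f ` ?D" for x y
  proof -
    obtain c where c: "x = f c" "c \<in> ?D" using xy(1) by (rule imageE)
    obtain d where d: "y = f d" "d \<in> ?D" using xy(2) by (rule imageE)
    note cd = c(2) d(2) c(1) d(1)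
    obtain e where "e \<in> ?D" "c \<sqsubseteq>\<^bsub>L\<^esub> e" "d \<sqsubseteq>\<^bsub>L\<^esub> e"
      using L.rather_below_directed(2) [OF a cd(1,2)] by blast
    then show ?thesis using cd by (intro bexI [of _ "f e"]) (auto intro: map_mono)
  qed
  moreover have "f ` ?D \<subseteq> carrier M" by auto
  ultimately obtain c where c: "c \<in> carrier L" "rather_below L c a" "b \<squnion>\<^bsub>M\<^esub> f c = \<top>\<^bsub>M\<^esub>"
    using M.compact_directed [OF b, of "f ` ?D"] top by auto
  have "f (L.neg c) \<sqinter>\<^bsub>M\<^esub> f c = \<bottom>\<^bsub>M\<^esub>"
    using c by (metis L.meet_neg L.neg_closed map_bot map_meet meet_comm)
  then have "f (L.neg c) \<sqsubseteq>\<^bsub>M\<^esub> b"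
    using c b by (intro M.le_of_join_eq_top [of _ "f c" b]) auto
  then have "L.neg c \<sqsubseteq>\<^bsub>L\<^esub> radj b" using b by (simp add: le_radj_iff)
  moreover have "a \<squnion>\<^bsub>L\<^esub> L.neg c = \<top>\<^bsub>L\<^esub>" using c by (simp add: L.rather_below_iff)
  ultimately have "a \<squnion>\<^bsub>L\<^esub> radj b = \<top>\<^bsub>L\<^esub>"
    using a by - (rule L.join_eq_top_mono_right [of a "L.neg c"], simp_all)
  then show "radj b \<squnion>\<^bsub>L\<^esub> a = \<top>\<^bsub>L\<^esub>" by (simp add: join_comm)
qed

lemma Xi_map_eq: "b \<in> Xi_points M \<Longrightarrow> Xi_map L M f b = radj b"
  by (simp add: Xi_map_def radj_def)

text \<open>The form of \<open>radj_join_eq_top\<close> from which both continuity of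
  \<open>Xi_map\<close> and naturality of \<open>Box\<close> are read off.\<close>

lemma Xi_map_preimage_Box:
  "a \<in> carrier L \<Longrightarrow> {b \<in> Xi_points M. Xi_map L M f b \<in> Box L a} = Box M (f a)"
  by (auto simp: Xi_map_eq L.mem_box M.mem_box radj_point radj_join_eq_top)

lemma continuous_Xi_map: "continuous_map (Xi M) (Xi L) (Xi_map L M f)"
  unfolding continuous_map_def
proof (intro conjI allI impI)
  show "Xi_map L M f \<in> topspace (Xi M) \<rightarrow> topspace (Xi L)"
    by (auto simp: Xi_map_eq radj_point)
  fix U assume U: "openin (Xi L) U"
  have "\<exists>a\<in>carrier M. b \<in> Box M a \<and> Box M a \<subseteq> {b \<in> Xi_points M. Xi_map L M f b \<in> U}"
    if b: "b \<in> Xi_points M" "Xi_map L M f b \<in> U" for b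
  proof -
    obtain a where a: "a \<in> carrier L" "Xi_map L M f b \<in> Box L a" "Box L a \<subseteq> U"
      by (rule L.openin_XiE [OF U b(2)])
    then have "b \<in> Box M (f a)" "Box M (f a) \<subseteq> {b \<in> Xi_points M. Xi_map L M f b \<in> U}"
      using b by (auto simp flip: Xi_map_preimage_Box)
    then show ?thesis using a by (intro bexI [of _ "f a"]) auto
  qed
  then show "openin (Xi M) {b \<in> topspace (Xi M). Xi_map L M f b \<in> U}"
    by (simp add: M.openin_Xi)
qed

lemma weakly_dense_Xi_map: "weakly_dense (Xi M) (Xi L) (Xi_map L M f)"
  unfolding weakly_dense_def
proof (intro ballI impI)
  fix b c
  assume "b \<in> topspace (Xi M)" "c \<in> topspace (Xi L)" "spec_le (Xi L) (Xi_map L M f b) c"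
  then have b: "b \<in> Xi_points M" and c: "c \<in> Xi_points L" and le: "radj b \<sqsubseteq>\<^bsub>L\<^esub> c"
    by (auto simp: L.spec_le_Xi Xi_map_eq)
  \<comment> \<open>In terms of closed sets, \<open>?b\<close> is the intersection of the one given
    by \<open>b\<close> with the preimage of the one given by \<open>c\<close>. It is nonempty
    because \<open>radj b \<squnion> c = c \<noteq> \<top>\<close>.\<close>
  let ?b = "b \<squnion>\<^bsub>M\<^esub> f c"
  have "radj b \<squnion>\<^bsub>L\<^esub> c = c" using c le L.le_iff_meet by simp
  then have "?b \<noteq> \<top>\<^bsub>M\<^esub>" using b c radj_join_eq_top [of c b] by (auto simp: L.mem_points M.mem_points)
  then have bp: "?b \<in> Xi_points M" using b c by (simp add: M.mem_points L.mem_points)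
  moreover have "spec_le (Xi M) b ?b" using b c bp by (simp add: M.spec_le_Xi M.join_left)
  moreover have "spec_le (Xi L) c (Xi_map L M f ?b)"
    using b c bp by (simp add: L.spec_le_Xi Xi_map_eq radj_point le_radj_iff M.join_right)
  ultimately show "\<exists>b'\<in>topspace (Xi M). spec_le (Xi M) b b' \<and> spec_le (Xi L) c (Xi_map L M f b')"
    by auto
qed

lemma Xi_map_in_dV_map: "Xi_map L M f \<in> dV_map (Xi M) (Xi L)"
proof -
  have "Xi_map L M f \<in> topspace (Xi M) \<rightarrow>\<^sub>E topspace (Xi L)"
    by (auto simp: Xi_map_eq radj_point) (simp add: Xi_map_def)
  then show ?thesis by (simp add: dV_map_def continuous_Xi_map weakly_dense_Xi_map)
qed

lemma Box_natural:
  "compose (carrier L) (wORO_map (Xi M) (Xi L) (Xi_map L M f)) (restrict (Box L) (carrier L))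
    = compose (carrier L) (restrict (Box M) (carrier M)) f"
proof
  fix a
  show "compose (carrier L) (wORO_map (Xi M) (Xi L) (Xi_map L M f)) (restrict (Box L) (carrier L)) a
    = compose (carrier L) (restrict (Box M) (carrier M)) f a"
  proof (cases "a \<in> carrier L")
    case True
    then show ?thesis
      by (simp add: compose_def wORO_map_def L.Box_in_carrier Xi_map_preimage_Box)
  qed (simp add: compose_def)
qed

end

lemma frame_hom_id: "(\<lambda>a\<in>carrier L. a) \<in> frame_hom L L" if "krframe L"
proof -
  interpret krframe L by fact
  have "(\<lambda>a\<in>carrier L. a) ` B = B" if "B \<subseteq> carrier L" for B using that by force
  then show ?thesis by (simp add: frame_hom_def)
qed

lemma frame_hom_compose:
  assumes "krframe L" "krframe M" "krframe N" "f \<in> frame_hom L M" "g \<in> frame_hom M N"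
  shows "compose (carrier L) g f \<in> frame_hom L N"
proof -
  interpret F: kr_hom L M f using assms by (simp add: kr_hom_def kr_hom_axioms_def)
  interpret G: kr_hom M N g using assms by (simp add: kr_hom_def kr_hom_axioms_def)
  have "compose (carrier L) g f (\<Squnion>\<^bsub>L\<^esub> B) = \<Squnion>\<^bsub>N\<^esub> (compose (carrier L) g f ` B)"
    if B: "B \<subseteq> carrier L" for B
  proof -
    have "compose (carrier L) g f ` B = g ` f ` B"
      using B by (auto simp: compose_def image_image intro!: image_cong)
    moreover have "f ` B \<subseteq> carrier M" using B by auto
    ultimately show ?thesis using B by (simp add: compose_def F.map_Sup G.map_Sup)
  qed
  then show ?thesis
    by (auto simp: frame_hom_def compose_def F.map_top G.map_top F.map_meet G.map_meet)
qed

lemma Xi_map_id: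
  assumes "krframe L" shows "Xi_map L L (\<lambda>a\<in>carrier L. a) = (\<lambda>b\<in>topspace (Xi L). b)"
proof -
  interpret H: kr_hom L L "\<lambda>a\<in>carrier L. a"
    using assms by (simp add: kr_hom_def kr_hom_axioms_def frame_hom_id)
  show ?thesis
  proof
    fix b
    show "Xi_map L L (\<lambda>a\<in>carrier L. a) b = (\<lambda>b\<in>topspace (Xi L). b) b"
    proof (cases "b \<in> Xi_points L")
      case True
      then have "H.radj b = b" by (intro H.L.eq_of_le_iff) (auto simp: H.le_radj_iff)
      then show ?thesis using True by (simp add: H.Xi_map_eq)
    qed (simp add: Xi_map_def)
  qed
qed

lemma Xi_map_compose:
  assumes "krframe L" "krframe M" "krframe N" "f \<in> frame_hom L M" "g \<in> frame_hom M N"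
  shows "Xi_map L N (compose (carrier L) g f)
    = compose (topspace (Xi N)) (Xi_map L M f) (Xi_map M N g)"
proof -
  interpret F: kr_hom L M f using assms by (simp add: kr_hom_def kr_hom_axioms_def)
  interpret G: kr_hom M N g using assms by (simp add: kr_hom_def kr_hom_axioms_def)
  interpret H: kr_hom L N "compose (carrier L) g f"
    using assms by (simp add: kr_hom_def kr_hom_axioms_def frame_hom_compose)
  show ?thesis
  proof
    fix b
    show "Xi_map L N (compose (carrier L) g f) b
      = compose (topspace (Xi N)) (Xi_map L M f) (Xi_map M N g) b"
    proof (cases "b \<in> Xi_points N")
      case True
      then have "H.radj b = F.radj (G.radj b)"
        by (intro F.L.eq_of_le_iff) (simp_all add: H.le_radj_iff F.le_radj_iff G.le_radj_iff compose_eq)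
      then show ?thesis
        using True by (simp add: compose_eq H.Xi_map_eq G.Xi_map_eq F.Xi_map_eq G.radj_point)
    qed (simp add: Xi_map_def compose_def)
  qed
qed

lemma continuous_map_spec_le:
  "\<lbrakk>continuous_map X Y f; spec_le X x x'\<rbrakk> \<Longrightarrow> spec_le Y (f x) (f x')"
  unfolding spec_le_def continuous_map_def by blast

section \<open>Inverse images under dV-maps\<close>

locale dV_hom = X: dV X + Y: dV Y for X :: "'a topology" and Y :: "'b topology" +
  fixes f
  assumes dV_map: "f \<in> dV_map X Y"
begin

lemma cont: "continuous_map X Y f"
  using dV_map by (simp add: dV_map_def)

lemma closed: "x \<in> topspace X \<Longrightarrow> f x \<in> topspace Y"
  using dV_map by (auto simp: dV_map_def)

lemma dense:
  assumes "spec_le Y (f x) y" "x \<in> topspace X"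
  obtains x' where "spec_le X x x'" "spec_le Y y (f x')"
proof -
  have "weakly_dense X Y f" using dV_map by (simp add: dV_map_def)
  then have "\<exists>x'\<in>topspace X. spec_le X x x' \<and> spec_le Y y (f x')"
    using assms spec_leD [OF assms(1)] unfolding weakly_dense_def by blast
  then show ?thesis using that by blast
qed

abbreviation pre :: "'b set \<Rightarrow> 'a set" where "pre V \<equiv> {x \<in> topspace X. f x \<in> V}"

lemma openin_pre: "openin Y V \<Longrightarrow> openin X (pre V)"
  using cont by (simp add: continuous_map_def)

text \<open>Hulls are defined by going up and then up again. Continuity transports such steps from
  \<open>X\<close> to \<open>Y\<close>, and weak density lifts steps in \<open>Y\<close> back to
  \<open>X\<close>, overshooting only upwards, which open sets tolerate.\<close>

lemma pre_ohull:
  assumes V: "openin Y V" shows "pre (ohull Y V) = ohull X (pre V)"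
proof (intro subset_antisym subsetI)
  fix x assume "x \<in> pre (ohull Y V)"
  then have x: "x \<in> topspace X" "f x \<in> ohull Y V" by auto
  have "x' \<in> down X (pre V)" if x': "spec_le X x x'" for x'
  proof -
    have "spec_le Y (f x) (f x')" using cont x' by (rule continuous_map_spec_le)
    then have "f x' \<in> down Y V" using x by (simp add: mem_ohull)
    then obtain y where y: "y \<in> V" "spec_le Y (f x') y" by (auto simp: mem_down)
    obtain x'' where x'': "spec_le X x' x''" "spec_le Y y (f x'')"
      by (rule dense [OF y(2)]) (use spec_leD [OF x'] in auto)
    have "f x'' \<in> V" using x''(2) V y(1) by (rule spec_le_openin)
    then show ?thesis using x''(1) spec_leD [OF x''(1)] by (auto simp: mem_down)
  qed
  then show "x \<in> ohull X (pre V)" using x by (simp add: mem_ohull)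
next
  fix x assume x: "x \<in> ohull X (pre V)"
  then have xt: "x \<in> topspace X" by (simp add: mem_ohull)
  have "y \<in> down Y V" if y: "spec_le Y (f x) y" for y
  proof -
    obtain x' where x': "spec_le X x x'" "spec_le Y y (f x')" by (rule dense [OF y xt])
    have "x' \<in> down X (pre V)" using x x'(1) by (simp add: mem_ohull)
    then obtain x'' where x'': "f x'' \<in> V" "spec_le X x' x''" by (auto simp: mem_down)
    have "spec_le Y (f x') (f x'')" using cont x''(2) by (rule continuous_map_spec_le)
    then have "spec_le Y y (f x'')" by (rule spec_le_trans [OF x'(2)])
    then show ?thesis using x''(1) by (auto simp: mem_down)
  qed
  then show "x \<in> pre (ohull Y V)" using xt closed by (simp add: mem_ohull)
qed

lemma pre_in_carrier: "U \<in> carrier (wORO Y) \<Longrightarrow> pre U \<in> carrier (wORO X)"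
  using pre_ohull [of U] by (simp add: X.carrier_wORO Y.carrier_wORO openin_pre)

lemma wORO_map_eq: "U \<in> carrier (wORO Y) \<Longrightarrow> wORO_map X Y f U = pre U"
  by (simp add: wORO_map_def)

lemma wORO_map_in_frame_hom: "wORO_map X Y f \<in> frame_hom (wORO Y) (wORO X)"
proof -
  interpret WX: krframe "wORO X" by (rule X.krframe_wORO)
  interpret WY: krframe "wORO Y" by (rule Y.krframe_wORO)
  have "wORO_map X Y f \<in> carrier (wORO Y) \<rightarrow>\<^sub>E carrier (wORO X)"
    using pre_in_carrier by (auto simp: wORO_map_def)
  moreover have "wORO_map X Y f \<top>\<^bsub>wORO Y\<^esub> = \<top>\<^bsub>wORO X\<^esub>"
  proof -
    have "wORO_map X Y f \<top>\<^bsub>wORO Y\<^esub> = pre \<top>\<^bsub>wORO Y\<^esub>" by (rule wORO_map_eq) simp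
    also have "\<dots> = topspace X" using closed by (auto simp: Y.top_wORO)
    finally show ?thesis by (simp add: X.top_wORO)
  qed
  moreover have "wORO_map X Y f (U \<sqinter>\<^bsub>wORO Y\<^esub> V) = wORO_map X Y f U \<sqinter>\<^bsub>wORO X\<^esub> wORO_map X Y f V"
    if "U \<in> carrier (wORO Y)" "V \<in> carrier (wORO Y)" for U V
  proof -
    have "pre (U \<inter> V) = pre U \<inter> pre V" by blast
    then show ?thesis
      using that by (simp add: Y.meet_wORO X.meet_wORO wORO_map_eq pre_in_carrier Y.Int_in_carrier)
  qed
  moreover have "wORO_map X Y f (\<Squnion>\<^bsub>wORO Y\<^esub> K) = \<Squnion>\<^bsub>wORO X\<^esub> (wORO_map X Y f ` K)"
    if K: "K \<subseteq> carrier (wORO Y)" for K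
  proof -
    have img: "wORO_map X Y f ` K = pre ` K" using K by (intro image_cong) (auto simp: wORO_map_eq)
    have sub: "pre ` K \<subseteq> carrier (wORO X)" using K pre_in_carrier by auto
    have "wORO_map X Y f (\<Squnion>\<^bsub>wORO Y\<^esub> K) = pre (ohull Y (\<Union>K))"
      using K by (simp add: Y.Sup_wORO wORO_map_eq Y.ohull_in_carrier Y.openin_Union_carrier)
    also have "\<dots> = ohull X (pre (\<Union>K))" using K by (intro pre_ohull Y.openin_Union_carrier)
    also have "pre (\<Union>K) = \<Union>(pre ` K)" by blast
    also have "ohull X (\<Union>(pre ` K)) = \<Squnion>\<^bsub>wORO X\<^esub> (pre ` K)" using sub by (simp only: X.Sup_wORO)
    finally show ?thesis by (simp only: img)
  qed
  ultimately show ?thesis unfolding frame_hom_def by blast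
qed

text \<open>Says that the right adjoint of \<open>wORO_map X Y f\<close> takes
  \<open>eps X x\<close> to \<open>eps Y (f x)\<close>, which is naturality of
  \<open>eps\<close>.\<close>

lemma pre_subset_eps_iff:
  assumes x: "x \<in> topspace X" and U: "U \<in> carrier (wORO Y)"
  shows "pre U \<subseteq> eps X x \<longleftrightarrow> U \<subseteq> eps Y (f x)"
proof
  have opU: "openin Y U" using U by (rule Y.carrier_openin)
  assume sub: "pre U \<subseteq> eps X x"
  show "U \<subseteq> eps Y (f x)"
  proof
    fix y assume y: "y \<in> U"
    have False if z: "spec_le Y y z" "spec_le Y (f x) z" for z
    proof -
      \<comment> \<open>A common upper bound \<open>z\<close> of \<open>y\<close> and
        \<open>f x\<close> is lifted to a point above \<open>x\<close>. Its image is in the up-set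
        \<open>U\<close>, so it belongs to \<open>eps X x\<close>, but no point above
        \<open>x\<close> does.\<close>
      obtain x' where x': "spec_le X x x'" "spec_le Y z (f x')" by (rule dense [OF z(2) x])
      have "f x' \<in> U" using spec_le_openin [OF spec_le_trans [OF z(1) x'(2)] opU y] .
      then have "x' \<in> eps X x" using sub spec_leD [OF x'(1)] by blast
      then show False using x x'(1) spec_le_refl [of x' X] spec_leD [OF x'(1)] by (auto simp: X.mem_eps)
    qed
    then show "y \<in> eps Y (f x)"
      using y openin_subset [OF opU] closed [OF x] by (auto simp: Y.mem_eps)
  qed
next
  assume sub: "U \<subseteq> eps Y (f x)"
  show "pre U \<subseteq> eps X x"
  proof
    fix x' assume x': "x' \<in> pre U"
    then have "f x' \<in> eps Y (f x)" using sub by blast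
    then have "\<not> spec_le X x z" if "spec_le X x' z" for z
      using that continuous_map_spec_le [OF cont] closed [OF x] Y.mem_eps by metis
    then show "x' \<in> eps X x" using x x' by (auto simp: X.mem_eps)
  qed
qed

lemma eps_natural:
  "compose (topspace X) (Xi_map (wORO Y) (wORO X) (wORO_map X Y f)) (restrict (eps X) (topspace X))
    = compose (topspace X) (restrict (eps Y) (topspace Y)) f"
proof
  fix x
  show "compose (topspace X) (Xi_map (wORO Y) (wORO X) (wORO_map X Y f)) (restrict (eps X) (topspace X)) x
    = compose (topspace X) (restrict (eps Y) (topspace Y)) f x"
  proof (cases "x \<in> topspace X")
    case x: True
    let ?K = "{U \<in> carrier (wORO Y). U \<subseteq> eps Y (f x)}"
    have "Xi_map (wORO Y) (wORO X) (wORO_map X Y f) (eps X x)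
      = \<Squnion>\<^bsub>wORO Y\<^esub> {U \<in> carrier (wORO Y). wORO_map X Y f U \<subseteq> eps X x}"
      using x X.eps_image by (auto simp: Xi_map_def)
    also have "{U \<in> carrier (wORO Y). wORO_map X Y f U \<subseteq> eps X x} = ?K"
      using x by (intro Collect_cong conj_cong HOL.refl) (simp add: wORO_map_eq pre_subset_eps_iff)
    also have "\<Squnion>\<^bsub>wORO Y\<^esub> ?K = ohull Y (\<Union>?K)" by (intro Y.Sup_wORO) blast
    also have "\<Union>?K = eps Y (f x)" using Y.eps_in_carrier by blast
    also have "ohull Y (eps Y (f x)) = eps Y (f x)" by (simp add: Y.carrier_ohull Y.eps_in_carrier)
    finally show ?thesis using x closed by (simp add: compose_eq)
  qed (simp add: compose_def)
qed

end

text \<open>The inverse is monotone for specialization, so \<open>g y\<close> serves as the required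
  lift of \<open>y\<close>. Homeomorphisms are therefore isomorphisms of the category.\<close>

lemma homeomorphic_maps_weakly_dense:
  assumes "homeomorphic_maps X Y f g" shows "weakly_dense X Y f"
  unfolding weakly_dense_def
proof (intro ballI impI)
  fix x y assume xy: "x \<in> topspace X" "y \<in> topspace Y" "spec_le Y (f x) y"
  have "spec_le X (g (f x)) (g y)"
    using assms xy(3) continuous_map_spec_le by (metis homeomorphic_maps_def)
  then show "\<exists>x'\<in>topspace X. spec_le X x x' \<and> spec_le Y y (f x')"
    using assms xy spec_leD [of X x "g y"] spec_le_refl [OF xy(2)]
    by (intro bexI [of _ "g y"]) (auto simp: homeomorphic_maps_def)
qed

lemma homeomorphic_map_in_dV_iso:
  assumes "homeomorphic_map X Y f" shows "restrict f (topspace X) \<in> dV_iso X Y"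
proof -
  obtain g where g: "homeomorphic_maps X Y f g" using assms homeomorphic_map_maps by blast
  then have fg: "homeomorphic_maps X Y (restrict f (topspace X)) (restrict g (topspace Y))"
    by (rule homeomorphic_maps_eq) auto
  let ?f = "restrict f (topspace X)" and ?g = "restrict g (topspace Y)"
  have "?f \<in> topspace X \<rightarrow>\<^sub>E topspace Y" "?g \<in> topspace Y \<rightarrow>\<^sub>E topspace X"
    using g by (simp_all add: homeomorphic_maps_def continuous_map_def restrict_PiE)
  then have "?f \<in> dV_map X Y" "?g \<in> dV_map Y X"
    using fg homeomorphic_maps_weakly_dense [OF fg]
      homeomorphic_maps_weakly_dense [OF homeomorphic_maps_sym [THEN iffD1, OF fg]]
    by (simp_all add: dV_map_def homeomorphic_maps_def)
  moreover have "\<forall>x\<in>topspace X. ?g (?f x) = x" "\<forall>y\<in>topspace Y. ?f (?g y) = y"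
    using fg by (auto simp: homeomorphic_maps_def)
  ultimately show ?thesis unfolding dV_iso_def by blast
qed

lemma dV_map_id: "(\<lambda>x\<in>topspace X. x) \<in> dV_map X X"
proof -
  have "homeomorphic_map X X id" by simp
  then show ?thesis using homeomorphic_map_in_dV_iso [of X X id] by (simp add: dV_iso_def id_def)
qed

lemma dV_map_compose:
  assumes f: "f \<in> dV_map X Y" and g: "g \<in> dV_map Y Z"
  shows "compose (topspace X) g f \<in> dV_map X Z"
proof -
  have fE: "f \<in> topspace X \<rightarrow>\<^sub>E topspace Y" "continuous_map X Y f" "weakly_dense X Y f"
    and gE: "g \<in> topspace Y \<rightarrow>\<^sub>E topspace Z" "continuous_map Y Z g" "weakly_dense Y Z g"
    using f g by (auto simp: dV_map_def)
  have "compose (topspace X) g f \<in> topspace X \<rightarrow>\<^sub>E topspace Z"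
    using fE gE by (auto simp: compose_def)
  moreover have "continuous_map X Z (compose (topspace X) g f)"
    using continuous_map_compose [OF fE(2) gE(2)] by (rule continuous_map_eq) (simp add: compose_eq)
  moreover have "weakly_dense X Z (compose (topspace X) g f)"
    unfolding weakly_dense_def
  proof (intro ballI impI)
    fix x z assume x: "x \<in> topspace X" and z: "z \<in> topspace Z"
      and "spec_le Z (compose (topspace X) g f x) z"
    then have le: "spec_le Z (g (f x)) z" by (simp add: compose_eq)
    have fx: "f x \<in> topspace Y" using fE x by auto
    \<comment> \<open>The lift is made in two stages: density of \<open>g\<close> moves
      \<open>z\<close> to a point above \<open>f x\<close>, and density of \<open>f\<close> moves
      that to a point above \<open>x\<close>.\<close>
    obtain y where y: "y \<in> topspace Y" "spec_le Y (f x) y" "spec_le Z z (g y)"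
      using gE(3) fx z le unfolding weakly_dense_def by blast
    obtain x' where x': "x' \<in> topspace X" "spec_le X x x'" "spec_le Y y (f x')"
      using fE(3) x y unfolding weakly_dense_def by blast
    have "spec_le Z (g y) (g (f x'))" using gE(2) x'(3) by (rule continuous_map_spec_le)
    then have "spec_le Z z (g (f x'))" by (rule spec_le_trans [OF y(3)])
    then show "\<exists>x'\<in>topspace X. spec_le X x x' \<and> spec_le Z z (compose (topspace X) g f x')"
      using x' by (intro bexI [of _ x']) (simp_all add: compose_eq)
  qed
  ultimately show ?thesis by (simp add: dV_map_def)
qed

lemma wORO_map_id: "wORO_map X X (\<lambda>x\<in>topspace X. x) = (\<lambda>U\<in>carrier (wORO X). U)"
proof
  fix U
  have "U \<in> carrier (wORO X) \<Longrightarrow> {x \<in> topspace X. x \<in> U} = U"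
    using openin_subset [of X U] by (auto simp: wORO_def)
  then show "wORO_map X X (\<lambda>x\<in>topspace X. x) U = (\<lambda>U\<in>carrier (wORO X). U) U"
    by (simp add: wORO_map_def cong: conj_cong)
qed

lemma wORO_map_compose:
  assumes "dV X" "dV Y" "dV Z" "f \<in> dV_map X Y" "g \<in> dV_map Y Z"
  shows "wORO_map X Z (compose (topspace X) g f)
    = compose (carrier (wORO Z)) (wORO_map X Y f) (wORO_map Y Z g)"
proof -
  interpret F: dV_hom X Y f using assms by (simp add: dV_hom_def dV_hom_axioms_def)
  interpret G: dV_hom Y Z g using assms by (simp add: dV_hom_def dV_hom_axioms_def)
  show ?thesis
  proof
    fix U
    show "wORO_map X Z (compose (topspace X) g f) U
      = compose (carrier (wORO Z)) (wORO_map X Y f) (wORO_map Y Z g) U"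
    proof (cases "U \<in> carrier (wORO Z)")
      case True
      then have "wORO_map X Y f (wORO_map Y Z g U) = {x \<in> topspace X. f x \<in> topspace Y \<and> g (f x) \<in> U}"
        by (simp add: G.wORO_map_eq F.wORO_map_eq G.pre_in_carrier)
      also have "\<dots> = {x \<in> topspace X. compose (topspace X) g f x \<in> U}"
        using F.closed by (auto simp: compose_eq)
      finally show ?thesis using True by (simp add: compose_eq wORO_map_def)
    qed (simp add: wORO_map_def compose_def)
  qed
qed

lemma compose_id_left:
  "f \<in> A \<rightarrow>\<^sub>E B \<Longrightarrow> compose A (\<lambda>y\<in>B. y) f = f"
  by (rule extensionalityI [of _ A]) (auto simp: compose_def PiE_iff)

lemma compose_id_right:
  "f \<in> A \<rightarrow>\<^sub>E B \<Longrightarrow> compose A f (\<lambda>x\<in>A. x) = f"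
  by (rule extensionalityI [of _ A]) (auto simp: compose_def PiE_iff)

section \<open>Categories, functors and natural isomorphisms\<close>

lemma category_KRFrm: "category KRFrm"
  unfolding category_def
proof (intro conjI ballI)
  fix L M N P :: "'a gorder" and f g h :: "'a \<Rightarrow> 'a"
  assume L: "L \<in> Obj KRFrm"
  then show "Ident KRFrm L \<in> Hom KRFrm L L"
    by (simp add: KRFrm_def frame_hom_id krframe_def)
  assume M: "M \<in> Obj KRFrm"
  {
    assume "f \<in> Hom KRFrm L M"
    then have "f \<in> carrier L \<rightarrow>\<^sub>E carrier M" by (simp add: KRFrm_def frame_hom_def)
    then show "Comp KRFrm L L M f (Ident KRFrm L) = f" "Comp KRFrm L M M (Ident KRFrm M) f = f"
      by (simp_all add: KRFrm_def compose_id_left compose_id_right)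
  }
  assume N: "N \<in> Obj KRFrm"
  {
    assume "f \<in> Hom KRFrm L M" "g \<in> Hom KRFrm M N"
    then show "Comp KRFrm L M N g f \<in> Hom KRFrm L N"
      using L M N by (simp add: KRFrm_def frame_hom_compose krframe_def)
  }
  assume "P \<in> Obj KRFrm" "f \<in> Hom KRFrm L M" "g \<in> Hom KRFrm M N" "h \<in> Hom KRFrm N P"
  then have "f \<in> carrier L \<rightarrow> carrier M" by (auto simp: KRFrm_def frame_hom_def)
  then show "Comp KRFrm L N P h (Comp KRFrm L M N g f) = Comp KRFrm L M P (Comp KRFrm M N P h g) f"
    by (simp add: KRFrm_def compose_assoc)
qed

lemma category_dVS: "category dVS"
  unfolding category_def
proof (intro conjI ballI)
  fix X Y Z W :: "'a topology" and f g h :: "'a \<Rightarrow> 'a"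
  show "Ident dVS X \<in> Hom dVS X X"
    by (simp add: dVS_def dV_map_id)
  {
    assume "f \<in> Hom dVS X Y"
    then have "f \<in> topspace X \<rightarrow>\<^sub>E topspace Y" by (simp add: dVS_def dV_map_def)
    then show "Comp dVS X X Y f (Ident dVS X) = f" "Comp dVS X Y Y (Ident dVS Y) f = f"
      by (simp_all add: dVS_def compose_id_left compose_id_right)
  }
  {
    assume "f \<in> Hom dVS X Y" "g \<in> Hom dVS Y Z"
    then show "Comp dVS X Y Z g f \<in> Hom dVS X Z"
      by (simp add: dVS_def dV_map_compose)
  }
  assume "f \<in> Hom dVS X Y" "g \<in> Hom dVS Y Z" "h \<in> Hom dVS Z W"
  then have "f \<in> topspace X \<rightarrow> topspace Y" by (auto simp: dVS_def dV_map_def)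
  then show "Comp dVS X Z W h (Comp dVS X Y Z g f) = Comp dVS X Y W (Comp dVS Y Z W h g) f"
    by (simp add: dVS_def compose_assoc)
qed

lemma contravariant_functor_Xi: "contravariant_functor KRFrm dVS Xi Xi_map"
  unfolding contravariant_functor_def
proof (intro conjI ballI category_KRFrm category_dVS)
  fix L M N :: "'a gorder" and f g :: "'a \<Rightarrow> 'a"
  assume "L \<in> Obj KRFrm"
  then have L: "krframe L" by (simp add: KRFrm_def krframe_def)
  show "Xi L \<in> Obj dVS" using krframe.dV_space_Xi [OF L] by (simp add: dVS_def)
  show "Xi_map L L (Ident KRFrm L) = Ident dVS (Xi L)"
    using Xi_map_id [OF L] by (simp add: KRFrm_def dVS_def)
  assume "M \<in> Obj KRFrm"
  then have M: "krframe M" by (simp add: KRFrm_def krframe_def)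
  {
    assume "f \<in> Hom KRFrm L M"
    then interpret kr_hom L M f
      using L M by (simp add: KRFrm_def kr_hom_def kr_hom_axioms_def)
    show "Xi_map L M f \<in> Hom dVS (Xi M) (Xi L)" using Xi_map_in_dV_map by (simp add: dVS_def)
  }
  assume "N \<in> Obj KRFrm" "f \<in> Hom KRFrm L M" "g \<in> Hom KRFrm M N"
  then show "Xi_map L N (Comp KRFrm L M N g f)
      = Comp dVS (Xi N) (Xi M) (Xi L) (Xi_map L M f) (Xi_map M N g)"
    using L M Xi_map_compose [of L M N f g] by (simp add: KRFrm_def dVS_def krframe_def)
qed

lemma contravariant_functor_wORO: "contravariant_functor dVS KRFrm wORO wORO_map"
  unfolding contravariant_functor_def
proof (intro conjI ballI category_KRFrm category_dVS)
  fix X Y Z :: "'a topology" and f g :: "'a \<Rightarrow> 'a"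
  assume "X \<in> Obj dVS"
  then have X: "dV X" by (simp add: dVS_def dV_def)
  show "wORO X \<in> Obj KRFrm"
    using dV.compact_regular_frame_wORO [OF X] by (simp add: KRFrm_def)
  show "wORO_map X X (Ident dVS X) = Ident KRFrm (wORO X)"
    by (simp add: KRFrm_def dVS_def wORO_map_id)
  assume "Y \<in> Obj dVS"
  then have Y: "dV Y" by (simp add: dVS_def dV_def)
  {
    assume "f \<in> Hom dVS X Y"
    then interpret dV_hom X Y f
      using X Y by (simp add: dVS_def dV_hom_def dV_hom_axioms_def)
    show "wORO_map X Y f \<in> Hom KRFrm (wORO Y) (wORO X)"
      using wORO_map_in_frame_hom by (simp add: KRFrm_def)
  }
  assume "Z \<in> Obj dVS" "f \<in> Hom dVS X Y" "g \<in> Hom dVS Y Z"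
  then show "wORO_map X Z (Comp dVS X Y Z g f)
      = Comp KRFrm (wORO Z) (wORO Y) (wORO X) (wORO_map X Y f) (wORO_map Y Z g)"
    using X Y wORO_map_compose [of X Y Z f g] by (simp add: KRFrm_def dVS_def dV_def)
qed

lemma natural_iso_Box: "natural_iso_wORO_Xi (\<lambda>L. restrict (Box L) (carrier L))"
  unfolding natural_iso_wORO_Xi_def
proof (intro conjI ballI)
  fix L M :: "'a gorder" and f :: "'a \<Rightarrow> 'a"
  assume "L \<in> Obj KRFrm"
  then have L: "krframe L" by (simp add: KRFrm_def krframe_def)
  then show "restrict (Box L) (carrier L) \<in> frame_iso L (wORO (Xi L))"
    by (rule krframe.Box_in_frame_iso)
  assume "M \<in> Obj KRFrm" "f \<in> Hom KRFrm L M"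
  then interpret kr_hom L M f
    using L by (simp add: KRFrm_def krframe_def kr_hom_def kr_hom_axioms_def)
  show "compose (carrier L) (wORO_map (Xi M) (Xi L) (Xi_map L M f)) (restrict (Box L) (carrier L))
    = compose (carrier L) (restrict (Box M) (carrier M)) f"
    by (rule Box_natural)
qed

lemma natural_iso_eps: "natural_iso_Xi_wORO (\<lambda>X. restrict (eps X) (topspace X))"
  unfolding natural_iso_Xi_wORO_def
proof (intro conjI ballI)
  fix X Y :: "'a topology" and f :: "'a \<Rightarrow> 'a"
  assume "X \<in> Obj dVS"
  then have X: "dV X" by (simp add: dVS_def dV_def)
  then show "restrict (eps X) (topspace X) \<in> dV_iso X (Xi (wORO X))"
    by (intro homeomorphic_map_in_dV_iso dV.homeomorphic_map_eps)
  assume "Y \<in> Obj dVS" "f \<in> Hom dVS X Y"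
  then interpret dV_hom X Y f
    using X by (simp add: dVS_def dV_def dV_hom_def dV_hom_axioms_def)
  show "compose (topspace X) (Xi_map (wORO Y) (wORO X) (wORO_map X Y f)) (restrict (eps X) (topspace X))
    = compose (topspace X) (restrict (eps Y) (topspace Y)) f"
    by (rule eps_natural)
qed

theorem theorem6p2:
  shows "(\<forall>L :: 'a gorder. compact_regular_frame L \<longrightarrow> frame_iso L (wORO (Xi L)) \<noteq> {}) \<and>
    (\<forall>X :: 'b topology. dV_space X \<longrightarrow> X homeomorphic_space Xi (wORO X)) \<and>
    contravariant_functor (KRFrm :: ('a gorder, 'a \<Rightarrow> 'a) cat) dVS Xi Xi_map \<and>
    contravariant_functor (dVS :: ('b topology, 'b \<Rightarrow> 'b) cat) KRFrm wORO wORO_map \<and>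
    (\<exists>\<eta> :: 'a gorder \<Rightarrow> 'a \<Rightarrow> 'a set. natural_iso_wORO_Xi \<eta>) \<and>
    (\<exists>\<epsilon> :: 'b topology \<Rightarrow> 'b \<Rightarrow> 'b set. natural_iso_Xi_wORO \<epsilon>)"
proof (intro conjI allI impI)
  fix L :: "'a gorder" assume "compact_regular_frame L"
  then show "frame_iso L (wORO (Xi L)) \<noteq> {}"
    using krframe.Box_in_frame_iso [of L] by (auto simp: krframe_def)
next
  fix X :: "'b topology" assume "dV_space X"
  then show "X homeomorphic_space Xi (wORO X)"
    using dV.homeomorphic_map_eps [of X] homeomorphic_map_imp_homeomorphic_space
    by (auto simp: dV_def)
next
  show "\<exists>\<eta> :: 'a gorder \<Rightarrow> 'a \<Rightarrow> 'a set. natural_iso_wORO_Xi \<eta>"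
    using natural_iso_Box by blast
  show "\<exists>\<epsilon> :: 'b topology \<Rightarrow> 'b \<Rightarrow> 'b set. natural_iso_Xi_wORO \<epsilon>"
    using natural_iso_eps by blast
qed (rule contravariant_functor_Xi contravariant_functor_wORO)+

end
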